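(* Let $\Gamma$ be a discrete countable group, and let $\mathcal{B}$ be the class of separable unital tracial $C^*$-algebras. (1) If $H^2(\Gamma,\mathbb{R})\neq 0$, then $\Gamma$ is not local-to-local $\mathcal{B}$-stable. (2) If the comparison map $J:H^2_b(\Gamma,\mathbb{R})\to H^2(\Gamma,\mathbb{R})$ is nonzero, then $\Gamma$ is not uniform-to-local $\mathcal{B}$-stable.
   Context: A unital $C^*$-algebra is called tracial here if it admits a tracial state. $U(B)$ is the unitary group of $B$. A map $\rho:\Gamma\to U(B)$ is unital if $\rho(e)=1$. For a class $\mathcal{B}$ of unital $C^*$-algebras: (a) $\Gamma$ is local-to-local $\mathcal{B}$-stable if for any sequence of unital maps $\rho_n:\Gamma\to U(B_n)$ with $B_n\in\mathcal{B}$ and $\lim_{n\to\infty}\|\rho_n(st)-\rho_n(s)\rho_n(t)\|=0$ for all $s,t\in\Gamma$, there exists a sequence of group homomorphisms $\pi_n:\Gamma\to U(B_n)$ with $\lim_{n\to\infty}\|\rho_n(s)-\pi_n(s)\|=0$ for all $s\in\Gamma$. (b) $\Gamma$ is uniform-to-local $\mathcal{B}$-stable if for any sequence of unital maps $\rho_n:\Gamma\to U(B_n)$ with $B_n\in\mathcal{B}$ and $\lim_{n\to\infty}\sup_{s,t\in\Gamma}\|\rho_n(st)-\rho_n(s)\rho_n(t)\|=0$, there exists a sequence of group homomorphisms $\pi_n:\Gamma\to U(B_n)$ with $\lim_{n\to\infty}\|\rho_n(s)-\pi_n(s)\|=0$ for all $s\in\Gamma$. $H^2(\Gamma,\mathbb{R})$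 is group cohomology with trivial coefficients (2-cocycles $\Gamma^2\to\mathbb{R}$ modulo coboundaries $\gamma(a)-\gamma(ab)+\gamma(b)$). $H^2_b(\Gamma,\mathbb{R})$ is bounded cohomology: defined in the same way, but with all cochains required to be bounded functions. $J$ is the canonical map sending the class of a bounded cocycle to its ordinary cohomology class. *)

theory Defs
  imports "HOL-Analysis.Analysis" "HOL-Algebra.Module" "HOL-Algebra.Product_Groups"
begin

section \<open>Unital C*-algebras\<close>

definition complex_field :: "complex ring" where
  "complex_field = \<lparr>carrier = UNIV, monoid.mult = (*), one = 1, zero = 0, add = (+)\<rparr>"

record 'a cstar_struct = "(complex, 'a) module" +
  adj :: "'a \<Rightarrow> 'a"
  cnorm :: "'a \<Rightarrow> real"

text \<open>The value outside the carrier is irrelevant; it is 0 because \<^locale>\<open>Metric_space\<close> wants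
  a distance that is nonnegative and symmetric on the whole type.\<close>

definition cdist :: "('a, 'm) cstar_struct_scheme \<Rightarrow> 'a \<Rightarrow> 'a \<Rightarrow> real" where
  "cdist B x y = (if x \<in> carrier B \<and> y \<in> carrier B then cnorm B (x \<ominus>\<^bsub>B\<^esub> y) else 0)"

text \<open>The locale \<open>algebra\<close> of HOL-Algebra is restricted to commutative algebras, hence the combination
  of \<^locale>\<open>ring\<close> and \<^locale>\<open>module\<close>.  The zero algebra is not excluded here, but
  it has no tracial state.\<close>

locale unital_cstar_algebra =
  ring B + module complex_field B for B :: "('a, 'm) cstar_struct_scheme" (structure) +
  assumes smult_mult_left:
      "\<lbrakk>x \<in> carrier B; y \<in> carrier B\<rbrakk> \<Longrightarrow> (c \<odot> x) \<otimes> y = c \<odot> (x \<otimes> y)"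
    and smult_mult_right:
      "\<lbrakk>x \<in> carrier B; y \<in> carrier B\<rbrakk> \<Longrightarrow> x \<otimes> (c \<odot> y) = c \<odot> (x \<otimes> y)"
    and adj_closed: "x \<in> carrier B \<Longrightarrow> adj B x \<in> carrier B"
    and adj_adj: "x \<in> carrier B \<Longrightarrow> adj B (adj B x) = x"
    and adj_add: "\<lbrakk>x \<in> carrier B; y \<in> carrier B\<rbrakk> \<Longrightarrow> adj B (x \<oplus> y) = adj B x \<oplus> adj B y"
    and adj_smult: "x \<in> carrier B \<Longrightarrow> adj B (c \<odot> x) = cnj c \<odot> adj B x"
    and adj_mult: "\<lbrakk>x \<in> carrier B; y \<in> carrier B\<rbrakk> \<Longrightarrow> adj B (x \<otimes> y) = adj B y \<otimes> adj B x"
    and cnorm_nonneg: "x \<in> carrier B \<Longrightarrow> 0 \<le> cnorm B x"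
    and cnorm_eq_zero: "x \<in> carrier B \<Longrightarrow> cnorm B x = 0 \<Longrightarrow> x = \<zero>"
    and cnorm_triangle:
      "\<lbrakk>x \<in> carrier B; y \<in> carrier B\<rbrakk> \<Longrightarrow> cnorm B (x \<oplus> y) \<le> cnorm B x + cnorm B y"
    and cnorm_smult: "x \<in> carrier B \<Longrightarrow> cnorm B (c \<odot> x) = cmod c * cnorm B x"
    and cnorm_mult:
      "\<lbrakk>x \<in> carrier B; y \<in> carrier B\<rbrakk> \<Longrightarrow> cnorm B (x \<otimes> y) \<le> cnorm B x * cnorm B y"
    and cstar_identity: "x \<in> carrier B \<Longrightarrow> cnorm B (adj B x \<otimes> x) = (cnorm B x)\<^sup>2"
    and complete: "Metric_space.mcomplete (carrier B) (cdist B)"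

definition separable_cstar :: "('a, 'm) cstar_struct_scheme \<Rightarrow> bool" where
  "separable_cstar B \<longleftrightarrow> separable_space (Metric_space.mtopology (carrier B) (cdist B))"

text \<open>Positivity is tested on the elements \<open>x\<^sup>* x\<close>, which are exactly the positive elements; a positive
  functional on a unital C*-algebra has norm 1 iff it maps the unit to 1.\<close>

definition tracial_state :: "('a, 'm) cstar_struct_scheme \<Rightarrow> ('a \<Rightarrow> complex) \<Rightarrow> bool" where
  "tracial_state B \<tau> \<longleftrightarrow>
     (\<forall>x\<in>carrier B. \<forall>y\<in>carrier B. \<tau> (x \<oplus>\<^bsub>B\<^esub> y) = \<tau> x + \<tau> y) \<and>
     (\<forall>c. \<forall>x\<in>carrier B. \<tau> (c \<odot>\<^bsub>B\<^esub> x) = c * \<tau> x) \<and>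
     (\<forall>x\<in>carrier B. \<tau> (adj B x \<otimes>\<^bsub>B\<^esub> x) \<in> \<real>\<^sub>\<ge>\<^sub>0) \<and>
     \<tau> \<one>\<^bsub>B\<^esub> = 1 \<and>
     (\<forall>x\<in>carrier B. \<forall>y\<in>carrier B. \<tau> (x \<otimes>\<^bsub>B\<^esub> y) = \<tau> (y \<otimes>\<^bsub>B\<^esub> x))"

text \<open>A set of algebras must live on one element type.  The type \<open>nat \<Rightarrow> complex\<close> loses
  nothing: a separable metric space with dense sequence \<open>q\<close> injects into it by
  \<open>x \<mapsto> (\<lambda>n. d(x, q n))\<close>, so transporting the structure makes every separable C*-algebra,
  over whatever type, isometrically *-isomorphic to one carried by a subset of
  \<open>nat \<Rightarrow> complex\<close>; and the stability notions below only depend on the isomorphism classes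
  of the algebras.\<close>

definition separable_tracial_algebras :: "'a cstar_struct set" where
  "separable_tracial_algebras =
     {B. unital_cstar_algebra B \<and> separable_cstar B \<and> (\<exists>\<tau>. tracial_state B \<tau>)}"

definition unitary_group :: "('a, 'm) cstar_struct_scheme \<Rightarrow> 'a monoid" where
  "unitary_group B =
     \<lparr>carrier = {u \<in> carrier B. adj B u \<otimes>\<^bsub>B\<^esub> u = \<one>\<^bsub>B\<^esub> \<and> u \<otimes>\<^bsub>B\<^esub> adj B u = \<one>\<^bsub>B\<^esub>},
      monoid.mult = monoid.mult B, one = \<one>\<^bsub>B\<^esub>\<rparr>"


section \<open>Stability\<close>

definition unital_unitary_map ::
  "('g, 'k) monoid_scheme \<Rightarrow> ('a, 'm) cstar_struct_scheme \<Rightarrow> ('g \<Rightarrow> 'a) \<Rightarrow> bool" where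
  "unital_unitary_map \<Gamma> B \<rho> \<longleftrightarrow>
     \<rho> \<in> carrier \<Gamma> \<rightarrow> carrier (unitary_group B) \<and> \<rho> \<one>\<^bsub>\<Gamma>\<^esub> = \<one>\<^bsub>B\<^esub>"

definition defect ::
  "('g, 'k) monoid_scheme \<Rightarrow> ('a, 'm) cstar_struct_scheme \<Rightarrow> ('g \<Rightarrow> 'a) \<Rightarrow> 'g \<Rightarrow> 'g \<Rightarrow> real" where
  "defect \<Gamma> B \<rho> s t = cnorm B (\<rho> (s \<otimes>\<^bsub>\<Gamma>\<^esub> t) \<ominus>\<^bsub>B\<^esub> \<rho> s \<otimes>\<^bsub>B\<^esub> \<rho> t)"

definition pointwise_near_homs ::
  "('g, 'k) monoid_scheme \<Rightarrow> (nat \<Rightarrow> ('a, 'm) cstar_struct_scheme) \<Rightarrow> (nat \<Rightarrow> 'g \<Rightarrow> 'a) \<Rightarrow> bool" where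
  "pointwise_near_homs \<Gamma> B \<rho> \<longleftrightarrow>
     (\<exists>\<pi>. (\<forall>n. \<pi> n \<in> hom \<Gamma> (unitary_group (B n))) \<and>
          (\<forall>s\<in>carrier \<Gamma>. (\<lambda>n. cnorm (B n) (\<rho> n s \<ominus>\<^bsub>B n\<^esub> \<pi> n s)) \<longlonglongrightarrow> 0))"

definition local_to_local_stable ::
  "('g, 'k) monoid_scheme \<Rightarrow> ('a, 'm) cstar_struct_scheme set \<Rightarrow> bool" where
  "local_to_local_stable \<Gamma> \<B> \<longleftrightarrow>
     (\<forall>B \<rho>. (\<forall>n. B n \<in> \<B> \<and> unital_unitary_map \<Gamma> (B n) (\<rho> n)) \<longrightarrow>
            (\<forall>s\<in>carrier \<Gamma>. \<forall>t\<in>carrier \<Gamma>. (\<lambda>n. defect \<Gamma> (B n) (\<rho> n) s t) \<longlonglongrightarrow> 0) \<longrightarrow>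
            pointwise_near_homs \<Gamma> B \<rho>)"

text \<open>The supremum is over a set of reals bounded by 2, since unitaries have norm at most 1.\<close>

definition uniform_to_local_stable ::
  "('g, 'k) monoid_scheme \<Rightarrow> ('a, 'm) cstar_struct_scheme set \<Rightarrow> bool" where
  "uniform_to_local_stable \<Gamma> \<B> \<longleftrightarrow>
     (\<forall>B \<rho>. (\<forall>n. B n \<in> \<B> \<and> unital_unitary_map \<Gamma> (B n) (\<rho> n)) \<longrightarrow>
            (\<lambda>n. SUP (s, t)\<in>carrier \<Gamma> \<times> carrier \<Gamma>. defect \<Gamma> (B n) (\<rho> n) s t) \<longlonglongrightarrow> 0 \<longrightarrow>
            pointwise_near_homs \<Gamma> B \<rho>)"


section \<open>Second cohomology with trivial real coefficients\<close>

text \<open>Cochains are extensional functions, so that equal cochains are equal as HOL functions.\<close>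

definition real_add_group :: "real monoid" where
  "real_add_group = \<lparr>carrier = UNIV, monoid.mult = (+), one = 0\<rparr>"

abbreviation cochains1 :: "('g, 'k) monoid_scheme \<Rightarrow> ('g \<Rightarrow> real) monoid" where
  "cochains1 \<Gamma> \<equiv> product_group (carrier \<Gamma>) (\<lambda>_. real_add_group)"

abbreviation cochains2 :: "('g, 'k) monoid_scheme \<Rightarrow> ('g \<times> 'g \<Rightarrow> real) monoid" where
  "cochains2 \<Gamma> \<equiv> product_group (carrier \<Gamma> \<times> carrier \<Gamma>) (\<lambda>_. real_add_group)"

definition coboundary :: "('g, 'k) monoid_scheme \<Rightarrow> ('g \<Rightarrow> real) \<Rightarrow> 'g \<times> 'g \<Rightarrow> real" where
  "coboundary \<Gamma> \<gamma> = (\<lambda>(a, b)\<in>carrier \<Gamma> \<times> carrier \<Gamma>. \<gamma> a - \<gamma> (a \<otimes>\<^bsub>\<Gamma>\<^esub> b) + \<gamma> b)"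

definition cocycles2 :: "('g, 'k) monoid_scheme \<Rightarrow> ('g \<times> 'g \<Rightarrow> real) set" where
  "cocycles2 \<Gamma> = {\<omega> \<in> carrier (cochains2 \<Gamma>).
     \<forall>a\<in>carrier \<Gamma>. \<forall>b\<in>carrier \<Gamma>. \<forall>c\<in>carrier \<Gamma>.
       \<omega> (b, c) - \<omega> (a \<otimes>\<^bsub>\<Gamma>\<^esub> b, c) + \<omega> (a, b \<otimes>\<^bsub>\<Gamma>\<^esub> c) - \<omega> (a, b) = 0}"

definition coboundaries2 :: "('g, 'k) monoid_scheme \<Rightarrow> ('g \<times> 'g \<Rightarrow> real) set" where
  "coboundaries2 \<Gamma> = coboundary \<Gamma> ` carrier (cochains1 \<Gamma>)"

definition bounded_cocycles2 :: "('g, 'k) monoid_scheme \<Rightarrow> ('g \<times> 'g \<Rightarrow> real) set" where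
  "bounded_cocycles2 \<Gamma> = {\<omega> \<in> cocycles2 \<Gamma>. bounded (\<omega> ` (carrier \<Gamma> \<times> carrier \<Gamma>))}"

definition bounded_coboundaries2 :: "('g, 'k) monoid_scheme \<Rightarrow> ('g \<times> 'g \<Rightarrow> real) set" where
  "bounded_coboundaries2 \<Gamma> =
     coboundary \<Gamma> ` {\<gamma> \<in> carrier (cochains1 \<Gamma>). bounded (\<gamma> ` carrier \<Gamma>)}"

definition H2 :: "('g, 'k) monoid_scheme \<Rightarrow> ('g \<times> 'g \<Rightarrow> real) set monoid" where
  "H2 \<Gamma> = (cochains2 \<Gamma>)\<lparr>carrier := cocycles2 \<Gamma>\<rparr> Mod coboundaries2 \<Gamma>"

definition H2b :: "('g, 'k) monoid_scheme \<Rightarrow> ('g \<times> 'g \<Rightarrow> real) set monoid" where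
  "H2b \<Gamma> = (cochains2 \<Gamma>)\<lparr>carrier := bounded_cocycles2 \<Gamma>\<rparr> Mod bounded_coboundaries2 \<Gamma>"

text \<open>The cosets \<open>coboundaries2 \<Gamma> + \<omega>\<close> for \<open>\<omega>\<close> in one bounded class all coincide, as
  bounded coboundaries are coboundaries; \<^const>\<open>the_elem\<close> picks this common coset.\<close>

definition comparison_map ::
  "('g, 'k) monoid_scheme \<Rightarrow> ('g \<times> 'g \<Rightarrow> real) set \<Rightarrow> ('g \<times> 'g \<Rightarrow> real) set" where
  "comparison_map \<Gamma> X = the_elem ((\<lambda>\<omega>. coboundaries2 \<Gamma> #>\<^bsub>cochains2 \<Gamma>\<^esub> \<omega>) ` X)"

end

theory Submission
  imports Defs
begin

text \<open>For a 2-cocycle \<open>\<omega>\<close> normalized by \<open>\<omega>(e, e) = 0\<close>, the closed span \<open>S\<close> of the operators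
  \<open>U s\<close> of the regular representation twisted by \<open>\<sigma>\<^sub>n = exp (i \<omega> / n)\<close> is a separable tracial
  C*-algebra, and \<open>s \<mapsto> U s\<close> has defect \<open>|1 - \<sigma>\<^sub>n|\<close>, which tends to 0 (uniformly if \<open>\<omega>\<close> is bounded).
  Suppose homomorphisms \<open>\<pi>\<close> are close to \<open>U\<close> on a finite set.  By the trace property,
  \<open>\<tau> \<circ> log\<close> is additive on products of elements near 1 and invariant under unitary
  conjugation.  Applied to the unitaries \<open>U s (\<pi> s)\<^sup>*\<close> it shows that \<open>\<omega> / n\<close>, hence \<open>\<omega>\<close>, is a
  coboundary on that finite set.  A system of linear equations in finitely many unknowns each is
  solvable if all its finite subsystems are, so \<open>\<omega>\<close> is a coboundary.\<close>

section \<open>The Hilbert space of square summable families\<close>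

text \<open>The unitaries obtained from a nearby homomorphism exhibit
  \<open>exp (i \<omega> / n)\<close> as a coboundary only with values in a noncommutative group,
  whereas a real cochain is wanted. The imaginary part of the trace of the logarithm bridges the
  gap: close to 1 the logarithm has no branch ambiguity, so angles are lifted from the circle to the
  reals, and the trace removes the commutators that keep the logarithm from being additive. Division
  by n, possible with real coefficients, brings the twist into that range without losing the class.
  The operator logarithm is never formed. Only the real series of traces of powers occurs, and it is
  differentiated along a path. Closeness to a homomorphism is pointwise, so for a given n it is
  usable only on a finite set of pairs, and the cochains found on different finite sets need not be
  compatible. This is the obstacle that the final passage from finite systems to the infinite one
  overcomes.\<close>

lemma inner_eqI:
  fixes x y :: "'a::real_inner"
  assumes "\<And>z. z \<bullet> x = z \<bullet> y"
  shows "x = y"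
  by (rule vector_eq_ldot[THEN iffD1, OF allI, OF assms])

definition square_summable :: "('i \<Rightarrow> complex) \<Rightarrow> bool" where
  "square_summable f \<longleftrightarrow> (\<lambda>i. (cmod (f i))\<^sup>2) summable_on UNIV"

lemma square_summable_0: "square_summable (\<lambda>i. 0)"
  by (simp add: square_summable_def)

lemma square_summable_add:
  assumes "square_summable f" "square_summable g"
  shows "square_summable (\<lambda>i. f i + g i)"
  unfolding square_summable_def
proof (rule summable_on_comparison_test)
  show "(\<lambda>i. 2 * (cmod (f i))\<^sup>2 + 2 * (cmod (g i))\<^sup>2) summable_on UNIV"
    using assms unfolding square_summable_def
    by (intro summable_on_add summable_on_cmult_right) auto
  fix i
  have "(cmod (f i + g i))\<^sup>2 \<le> (cmod (f i) + cmod (g i))\<^sup>2"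
    by (intro power_mono norm_triangle_ineq) auto
  also have "\<dots> \<le> 2 * (cmod (f i))\<^sup>2 + 2 * (cmod (g i))\<^sup>2"
    using sum_squares_bound[of "cmod (f i)" "cmod (g i)"] by (simp add: power2_sum)
  finally show "(cmod (f i + g i))\<^sup>2 \<le> 2 * (cmod (f i))\<^sup>2 + 2 * (cmod (g i))\<^sup>2" .
qed auto

lemma square_summable_mult:
  assumes "square_summable f" and "\<And>i. cmod (w i) \<le> C"
  shows "square_summable (\<lambda>i. w i * f i)"
  unfolding square_summable_def
proof (rule summable_on_comparison_test)
  show "(\<lambda>i. C\<^sup>2 * (cmod (f i))\<^sup>2) summable_on UNIV"
    using assms unfolding square_summable_def by (intro summable_on_cmult_right) auto
  fix i
  show "(cmod (w i * f i))\<^sup>2 \<le> C\<^sup>2 * (cmod (f i))\<^sup>2"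
    unfolding norm_mult power_mult_distrib
    by (intro mult_right_mono power_mono assms(2)) auto
qed auto

lemma square_summable_cmult: "square_summable f \<Longrightarrow> square_summable (\<lambda>i. c * f i)"
  by (rule square_summable_mult[where C = "cmod c"]) auto

lemma square_summable_reindex:
  "square_summable f \<Longrightarrow> bij h \<Longrightarrow> square_summable (\<lambda>i. f (h i))"
  unfolding square_summable_def
  using summable_on_reindex_bij_betw[of h UNIV UNIV "\<lambda>i. (cmod (f i))\<^sup>2"] by simp

lemma square_summable_indicator: "square_summable (\<lambda>i. if i = j then 1 else 0)"
proof -
  have "(\<lambda>i. (cmod (if i = j then 1 else 0))\<^sup>2) summable_on {j}"
    by (rule summable_on_finite) auto
  then show ?thesis
    unfolding square_summable_def
    by (subst (asm) summable_on_cong_neutral[of UNIV "{j}"]) auto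
qed

lemma summable_on_inner_complex:
  fixes f g :: "'i \<Rightarrow> complex"
  assumes "square_summable f" "square_summable g"
  shows "(\<lambda>i. f i \<bullet> g i) summable_on UNIV"
proof -
  have "(\<lambda>i. norm (f i \<bullet> g i)) summable_on UNIV"
  proof (rule summable_on_comparison_test)
    show "(\<lambda>i. (cmod (f i))\<^sup>2 + (cmod (g i))\<^sup>2) summable_on UNIV"
      using assms unfolding square_summable_def by (intro summable_on_add) auto
    fix i
    have "\<bar>f i \<bullet> g i\<bar> \<le> cmod (f i) * cmod (g i)" by (rule Cauchy_Schwarz_ineq2)
    also have "\<dots> \<le> (cmod (f i))\<^sup>2 + (cmod (g i))\<^sup>2"
      using sum_squares_bound[of "cmod (f i)" "cmod (g i)"] 
        mult_nonneg_nonneg[OF norm_ge_zero norm_ge_zero, of "f i" "g i"] by linarith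
    finally show "norm (f i \<bullet> g i) \<le> (cmod (f i))\<^sup>2 + (cmod (g i))\<^sup>2" by simp
  qed auto
  then show ?thesis by (rule abs_summable_summable)
qed

text \<open>The inner product put on this type is the real part of the Hermitian one. The norm is
  the same, and pairing with i times a vector (\<open>cmul\<close>) recovers the imaginary
  part.\<close>

typedef 'i ell2 = "{f :: 'i \<Rightarrow> complex. square_summable f}"
  morphisms coord Ell2
  using square_summable_0 by blast

setup_lifting type_definition_ell2

instantiation ell2 :: (type) real_inner
begin

lift_definition zero_ell2 :: "'i ell2" is "\<lambda>_. 0" by (rule square_summable_0)
lift_definition plus_ell2 :: "'i ell2 \<Rightarrow> 'i ell2 \<Rightarrow> 'i ell2" is "\<lambda>f g i. f i + g i"
  by (rule square_summable_add)
lift_definition uminus_ell2 :: "'i ell2 \<Rightarrow> 'i ell2" is "\<lambda>f i. - f i"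
  by (simp add: square_summable_def)
lift_definition minus_ell2 :: "'i ell2 \<Rightarrow> 'i ell2 \<Rightarrow> 'i ell2" is "\<lambda>f g i. f i - g i"
  using square_summable_add[of _ "\<lambda>i. - _ i"] by (force simp: square_summable_def)
lift_definition scaleR_ell2 :: "real \<Rightarrow> 'i ell2 \<Rightarrow> 'i ell2" is "\<lambda>r f i. complex_of_real r * f i"
  by (rule square_summable_cmult)
lift_definition inner_ell2 :: "'i ell2 \<Rightarrow> 'i ell2 \<Rightarrow> real" is "\<lambda>f g. \<Sum>\<^sub>\<infinity>i. f i \<bullet> g i" .

definition norm_ell2 :: "'i ell2 \<Rightarrow> real" where "norm_ell2 f = sqrt (f \<bullet> f)"
definition dist_ell2 :: "'i ell2 \<Rightarrow> 'i ell2 \<Rightarrow> real" where "dist_ell2 f g = norm (f - g)"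
definition sgn_ell2 :: "'i ell2 \<Rightarrow> 'i ell2" where "sgn_ell2 f = scaleR (inverse (norm f)) f"
definition uniformity_ell2 :: "('i ell2 \<times> 'i ell2) filter" where
  "uniformity_ell2 = (INF e\<in>{0<..}. principal {(x, y). dist x y < e})"
definition open_ell2 :: "'i ell2 set \<Rightarrow> bool" where
  "open_ell2 S = (\<forall>x\<in>S. \<forall>\<^sub>F (x', y) in uniformity. x' = x \<longrightarrow> y \<in> S)"

instance
proof
  fix x y z :: "'i ell2" and r s :: real
  show "x + y + z = x + (y + z)" "x + y = y + x" "0 + x = x" "- x + x = 0" "x - y = x + - y"
    "r *\<^sub>R (x + y) = r *\<^sub>R x + r *\<^sub>R y" "(r + s) *\<^sub>R x = r *\<^sub>R x + s *\<^sub>R x" "r *\<^sub>R s *\<^sub>R x = (r * s) *\<^sub>R x"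
    "1 *\<^sub>R x = x"
    by (transfer; simp add: algebra_simps fun_eq_iff)+
  show "inner x y = inner y x"
    by transfer (simp add: inner_commute)
  show "inner (x + y) z = inner x z + inner y z"
    by transfer (simp add: inner_add_left infsum_add summable_on_inner_complex)
  show "inner (r *\<^sub>R x) y = r * inner x y"
  proof transfer
    fix r and f g :: "'i \<Rightarrow> complex"
    assume "square_summable f" "square_summable g"
    have "(\<lambda>i. (complex_of_real r * f i) \<bullet> g i) = (\<lambda>i. r * (f i \<bullet> g i))"
      by (simp add: inner_complex_def algebra_simps)
    then show "(\<Sum>\<^sub>\<infinity>i. (complex_of_real r * f i) \<bullet> g i) = r * (\<Sum>\<^sub>\<infinity>i. f i \<bullet> g i)"
      by (simp add: infsum_cmult_right')
  qed
  show "0 \<le> inner x x"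
    by transfer (auto intro: infsum_nonneg)
  show "inner x x = 0 \<longleftrightarrow> x = 0"
  proof transfer
    fix f :: "'i \<Rightarrow> complex"
    assume f: "square_summable f"
    show "((\<Sum>\<^sub>\<infinity>i. f i \<bullet> f i) = 0) = (f = (\<lambda>_. 0))"
    proof
      assume "(\<Sum>\<^sub>\<infinity>i. f i \<bullet> f i) = 0"
      then have "f i \<bullet> f i = 0" for i
        by (intro nonneg_infsum_le_0D[OF _ summable_on_inner_complex[OF f f], of i]) simp_all
      then show "f = (\<lambda>_. 0)" by (simp add: fun_eq_iff)
    qed simp
  qed
qed (simp_all add: dist_ell2_def sgn_ell2_def uniformity_ell2_def open_ell2_def norm_ell2_def)

end

declare zero_ell2.rep_eq [simp] plus_ell2.rep_eq [simp] minus_ell2.rep_eq [simp]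
  uminus_ell2.rep_eq [simp] scaleR_ell2.rep_eq [simp]

lemma ell2_eqI: "(\<And>i. coord f i = coord g i) \<Longrightarrow> f = g"
  by (simp add: coord_inject[symmetric] fun_eq_iff)

lemma norm_ell2_sq: "(norm f)\<^sup>2 = (\<Sum>\<^sub>\<infinity>i. (cmod (coord f i))\<^sup>2)"
  unfolding dot_square_norm[symmetric] by (simp add: inner_ell2.rep_eq power2_norm_eq_inner)

lemma square_summable_coord: "square_summable (coord f)"
  using coord[of f] by simp

lemma summable_coord: "(\<lambda>i. (cmod (coord f i))\<^sup>2) summable_on UNIV"
  using coord[of f] by (simp add: square_summable_def)

lemma sum_coord_le: "finite F \<Longrightarrow> (\<Sum>i\<in>F. (cmod (coord f i))\<^sup>2) \<le> (norm f)\<^sup>2"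
  unfolding norm_ell2_sq by (rule finite_sum_le_infsum[OF summable_coord]) auto

lemma cmod_coord_le: "cmod (coord f i) \<le> norm f"
proof (rule power2_le_imp_le)
  have "(\<Sum>i\<in>{i}. (cmod (coord f i))\<^sup>2) \<le> (norm f)\<^sup>2"
    by (rule sum_coord_le) (rule finite.intros)+
  then show "(cmod (coord f i))\<^sup>2 \<le> (norm f)\<^sup>2" by (subst (asm) sum.insert) auto
qed (rule norm_ge_zero)

lemma bounded_linear_coord: "bounded_linear (\<lambda>f. coord f i)"
  by (rule bounded_linear_intro[where K = 1]) (auto simp: scaleR_conv_of_real cmod_coord_le)

text \<open>Made for limits: bounds on finite partial sums survive convergence of the coordinates,
  so a coordinatewise limit inherits square summability and the bound.\<close>

lemma ell2_bounded_partial_sums: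
  assumes "\<And>F. finite F \<Longrightarrow> (\<Sum>i\<in>F. (cmod (g i))\<^sup>2) \<le> C\<^sup>2" and "0 \<le> C"
  shows "square_summable g" and "norm (Ell2 g) \<le> C"
proof -
  show g: "square_summable g"
    unfolding square_summable_def
    by (rule nonneg_bounded_partial_sums_imp_summable_on[where C = "C\<^sup>2"])
      (auto simp: eventually_finite_subsets_at_top assms intro!: exI[of _ "{}"])
  have "(norm (Ell2 g))\<^sup>2 \<le> C\<^sup>2"
    unfolding norm_ell2_sq using g
    by (subst Ell2_inverse) (auto simp: square_summable_def assms intro!: infsum_le_finite_sums)
  then show "norm (Ell2 g) \<le> C"
    using assms(2) by (rule power2_le_imp_le)
qed

instance ell2 :: (type) complete_space
proof
  fix X :: "nat \<Rightarrow> 'a ell2"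
  assume X: "Cauchy X"
  have "Cauchy (\<lambda>n. coord (X n) i)" for i
    using X by (rule bounded_linear.Cauchy[OF bounded_linear_coord])
  then obtain g where g: "\<And>i. (\<lambda>n. coord (X n) i) \<longlonglongrightarrow> g i"
    unfolding Cauchy_convergent_iff convergent_def by metis
  \<comment> \<open>Fatou's argument: on each finite set of coordinates let \<open>m\<close> tend to
    infinity. With e = 1 it yields that \<open>g\<close> is square summable, with e = r / 2 that
    \<open>X\<close> converges to it.\<close>
  have tail: "square_summable (\<lambda>i. coord (X n) i - g i) \<and> norm (Ell2 (\<lambda>i. coord (X n) i - g i)) \<le> e"
    if e: "0 \<le> e" and n: "\<And>m. m \<ge> n \<Longrightarrow> norm (X n - X m) \<le> e" for n e
  proof -
    have "(\<Sum>i\<in>F. (cmod (coord (X n) i - g i))\<^sup>2) \<le> e\<^sup>2" if "finite F" for F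
    proof (rule tendsto_upperbound)
      show "(\<lambda>m. \<Sum>i\<in>F. (cmod (coord (X n) i - coord (X m) i))\<^sup>2) \<longlonglongrightarrow> (\<Sum>i\<in>F. (cmod (coord (X n) i - g i))\<^sup>2)"
        by (intro tendsto_intros g)
      show "\<forall>\<^sub>F m in sequentially. (\<Sum>i\<in>F. (cmod (coord (X n) i - coord (X m) i))\<^sup>2) \<le> e\<^sup>2"
        using eventually_ge_at_top[of n]
      proof eventually_elim
        case (elim m)
        have "(\<Sum>i\<in>F. (cmod (coord (X n - X m) i))\<^sup>2) \<le> (norm (X n - X m))\<^sup>2"
          by (rule sum_coord_le[OF that])
        also have "\<dots> \<le> e\<^sup>2" using n[OF elim] by (intro power_mono) auto
        finally show ?case by simp
      qed
    qed simp
    then show ?thesis using ell2_bounded_partial_sums[OF _ e, of "\<lambda>i. coord (X n) i - g i"] by simp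
  qed
  obtain N where N: "\<And>m n. m \<ge> N \<Longrightarrow> n \<ge> N \<Longrightarrow> norm (X n - X m) < 1"
    using X by (metis CauchyD zero_less_one)
  have "square_summable (\<lambda>i. coord (X N) i - g i)"
    using tail[OF zero_le_one less_imp_le[OF N[OF _ order_refl]]] by (rule conjunct1)
  then have "square_summable (\<lambda>i. coord (X N) i + (-1) * (coord (X N) i - g i))"
    using coord[of "X N"] by (intro square_summable_add square_summable_cmult) auto
  then have sg: "square_summable g" by simp
  have eq: "Ell2 (\<lambda>i. coord (X n) i - g i) = X n - Ell2 g" if "square_summable (\<lambda>i. coord (X n) i - g i)" for n
    by (rule ell2_eqI) (simp add: Ell2_inverse sg that)
  have "X \<longlonglongrightarrow> Ell2 g"
  proof (rule LIMSEQ_I)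
    fix r :: real assume r: "0 < r"
    obtain M where M: "\<And>m n. m \<ge> M \<Longrightarrow> n \<ge> M \<Longrightarrow> norm (X n - X m) < r / 2"
      using X r by (metis CauchyD half_gt_zero)
    have "norm (X n - Ell2 g) \<le> r / 2" if "n \<ge> M" for n
    proof -
      have "square_summable (\<lambda>i. coord (X n) i - g i) \<and>
          norm (Ell2 (\<lambda>i. coord (X n) i - g i)) \<le> r / 2"
        using that r by (intro tail less_imp_le[OF M]) auto
      then show ?thesis using eq[of n] by metis
    qed
    then show "\<exists>no. \<forall>n\<ge>no. norm (X n - Ell2 g) < r"
      using r by (intro exI[of _ M]) (smt (verit) field_sum_of_halves)
  qed
  then show "convergent X" by (auto simp: convergent_def)
qed

instance ell2 :: (type) banach ..

section \<open>Complex scalars and basis vectors\<close>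

lift_definition cmul :: "complex \<Rightarrow> 'i ell2 \<Rightarrow> 'i ell2" is "\<lambda>c f i. c * f i"
  by (rule square_summable_cmult)

declare cmul.rep_eq [simp]

lemma cmul_add: "cmul c (f + g) = cmul c f + cmul c g"
  and cmul_diff: "cmul c (f - g) = cmul c f - cmul c g"
  and cmul_uminus: "cmul c (- f) = - cmul c f"
  and cmul_zero: "cmul c 0 = 0"
  and cmul_add_left: "cmul (c + d) f = cmul c f + cmul d f"
  and cmul_cmul: "cmul c (cmul d f) = cmul (c * d) f"
  and cmul_of_real: "cmul (complex_of_real r) f = r *\<^sub>R f"
  and cmul_one: "cmul 1 f = f"
  by (rule ell2_eqI, simp add: algebra_simps)+

lemma cmul_scaleR: "cmul c (r *\<^sub>R f) = r *\<^sub>R cmul c f"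
  by (rule ell2_eqI) simp

lemma inner_cmul_left: "cmul c f \<bullet> g = f \<bullet> cmul (cnj c) g"
  by (simp add: inner_ell2.rep_eq inner_complex_def algebra_simps)

lemma norm_cmul: "norm (cmul c f) = cmod c * norm f"
proof (rule power2_eq_imp_eq)
  have "(norm (cmul c f))\<^sup>2 = f \<bullet> cmul (complex_of_real ((cmod c)\<^sup>2)) f"
    unfolding dot_square_norm[symmetric, where x = "cmul c f"] inner_cmul_left cmul_cmul
      complex_norm_square by (simp only: mult.commute)
  also have "\<dots> = (cmod c * norm f)\<^sup>2"
    by (simp only: cmul_of_real inner_scaleR_right dot_square_norm power_mult_distrib)
  finally show "(norm (cmul c f))\<^sup>2 = (cmod c * norm f)\<^sup>2" .
qed auto

text \<open>Multiplication by i is skew for the real inner product; in Hermitian terms the square of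
  a vector is real. Positivity of the trace rests on this.\<close>

lemma inner_cmul_ii_self: "f \<bullet> cmul \<i> f = 0"
proof -
  have "cmul (- \<i>) f = - cmul \<i> f"
    by (rule ell2_eqI) simp
  then show ?thesis
    using inner_cmul_left[of \<i> f f] by (simp add: inner_commute)
qed

lift_definition ket :: "'i \<Rightarrow> 'i ell2" is "\<lambda>j i. if i = j then 1 else 0"
  by (rule square_summable_indicator)

declare ket.rep_eq [simp]

text \<open>The choices c = 1 and c = \<i> read off the real and the imaginary part of a
  coordinate.\<close>

lemma inner_cmul_ket: "f \<bullet> cmul c (ket j) = coord f j \<bullet> c"
proof -
  have "f \<bullet> cmul c (ket j) = (\<Sum>\<^sub>\<infinity>i. if i = j then coord f i \<bullet> c else 0)"
    unfolding inner_ell2.rep_eq by (rule infsum_cong) auto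
  also have "\<dots> = (\<Sum>\<^sub>\<infinity>i\<in>{j}. coord f i \<bullet> c)"
    by (rule infsum_cong_neutral) auto
  finally show ?thesis by simp
qed

lemma norm_ket [simp]: "norm (ket j) = 1"
  using inner_cmul_ket[of "ket j" 1 j] by (simp add: cmul_one norm_eq_sqrt_inner inner_complex_def)

section \<open>Adjointable operators\<close>

text \<open>Adjoints are carried along as witnesses: sums, products and norm limits inherit one by
  an explicit formula, and the twisted translations come with one.\<close>

definition adjoint_pair :: "('i ell2 \<Rightarrow>\<^sub>L 'i ell2) \<Rightarrow> ('i ell2 \<Rightarrow>\<^sub>L 'i ell2) \<Rightarrow> bool" where
  "adjoint_pair T T' \<longleftrightarrow> (\<forall>f g. T f \<bullet> g = f \<bullet> T' g)"

definition complex_linear :: "('i ell2 \<Rightarrow>\<^sub>L 'i ell2) \<Rightarrow> bool" where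
  "complex_linear T \<longleftrightarrow> (\<forall>c f. T (cmul c f) = cmul c (T f))"

lemma adjoint_pair_unique:
  assumes "adjoint_pair T T'" "adjoint_pair T T''"
  shows "T' = T''"
proof (rule blinfun_eqI)
  fix g
  have "f \<bullet> T' g = f \<bullet> T'' g" for f
    using assms by (metis adjoint_pair_def)
  then show "T' g = T'' g" by (rule inner_eqI)
qed

lemma adjoint_pair_sym: "adjoint_pair T T' \<Longrightarrow> adjoint_pair T' T"
  unfolding adjoint_pair_def by (metis inner_commute)

lemma norm_adjoint_pair_le:
  assumes "adjoint_pair T T'"
  shows "norm T' \<le> norm T"
proof (rule norm_blinfun_bound)
  fix g
  have "(norm (T' g))\<^sup>2 = T (T' g) \<bullet> g"
    using assms by (simp add: adjoint_pair_def dot_square_norm)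
  also have "\<dots> \<le> norm (T (T' g)) * norm g" by (rule norm_cauchy_schwarz)
  also have "\<dots> \<le> (norm T * norm (T' g)) * norm g"
    by (intro mult_right_mono norm_blinfun norm_ge_zero)
  finally have "norm (T' g) * norm (T' g) \<le> norm (T' g) * (norm T * norm g)"
    by (simp add: power2_eq_square algebra_simps)
  then show "norm (T' g) \<le> norm T * norm g"
    by (cases "T' g = 0") auto
qed simp

lemma norm_adjoint_pair: "adjoint_pair T T' \<Longrightarrow> norm T' = norm T"
  by (meson adjoint_pair_sym norm_adjoint_pair_le order_antisym)

lemma adjoint_pair_diff: "adjoint_pair S S' \<Longrightarrow> adjoint_pair T T' \<Longrightarrow> adjoint_pair (S - T) (S' - T')"
  by (simp add: adjoint_pair_def blinfun.bilinear_simps inner_diff_left inner_diff_right)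

text \<open>The adjoint is taken for the real inner product, so its complex linearity is a fact to
  prove. It holds because \<open>cmul c\<close> has adjoint \<open>cmul (cnj c)\<close>, with which
  \<open>T\<close> commutes as well.\<close>

lemma complex_linear_adjoint_pair:
  assumes "adjoint_pair T T'" "complex_linear T"
  shows "complex_linear T'"
  unfolding complex_linear_def
proof (intro allI)
  fix c g
  have "f \<bullet> T' (cmul c g) = f \<bullet> cmul c (T' g)" for f
  proof -
    have "f \<bullet> T' (cmul c g) = cmul (cnj c) (T f) \<bullet> g"
      using assms(1) by (simp add: adjoint_pair_def inner_cmul_left)
    also have "\<dots> = cmul (cnj c) f \<bullet> T' g"
      using assms by (simp add: adjoint_pair_def complex_linear_def flip: assms(2)[unfolded complex_linear_def, rule_format])
    finally show ?thesis by (simp add: inner_cmul_left)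
  qed
  then show "T' (cmul c g) = cmul c (T' g)" by (rule inner_eqI)
qed

text \<open>As a type of their own these operators form a Banach algebra in the sense of type
  classes, so that power series and derivatives of operator paths are the ordinary ones.\<close>

typedef 'i operator =
  "{T :: 'i ell2 \<Rightarrow>\<^sub>L 'i ell2. complex_linear T \<and> (\<exists>T'. adjoint_pair T T')}"
  morphisms blin Operator
  by (rule exI[of _ 0]) (auto simp: complex_linear_def adjoint_pair_def cmul_zero intro!: exI[of _ 0])

setup_lifting type_definition_operator

lift_definition cmul_blinfun :: "complex \<Rightarrow> 'i ell2 \<Rightarrow>\<^sub>L 'i ell2" is cmul
proof -
  show "bounded_linear (cmul c :: 'i ell2 \<Rightarrow> _)" for c
    by (rule bounded_linear_intro[where K = "cmod c"])
      (simp_all add: cmul_add cmul_scaleR norm_cmul mult.commute)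
qed

declare cmul_blinfun.rep_eq [simp]

instantiation operator :: (type) real_normed_algebra_1
begin

lift_definition zero_operator :: "'i operator" is 0
  by (auto simp: complex_linear_def adjoint_pair_def cmul_zero intro!: exI[of _ 0])
lift_definition one_operator :: "'i operator" is id_blinfun
  by (auto simp: complex_linear_def adjoint_pair_def intro!: exI[of _ id_blinfun])
lift_definition plus_operator :: "'i operator \<Rightarrow> 'i operator \<Rightarrow> 'i operator" is "(+)"
proof safe
  fix S T S' T' :: "'i ell2 \<Rightarrow>\<^sub>L 'i ell2"
  assume "adjoint_pair S S'" "adjoint_pair T T'"
  then show "\<exists>R. adjoint_pair (S + T) R"
    by (intro exI[of _ "S' + T'"])
      (simp add: adjoint_pair_def blinfun.bilinear_simps inner_add_left inner_add_right)
qed (simp add: complex_linear_def blinfun.bilinear_simps cmul_add)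
lift_definition minus_operator :: "'i operator \<Rightarrow> 'i operator \<Rightarrow> 'i operator" is "(-)"
  using adjoint_pair_diff by (fastforce simp: complex_linear_def blinfun.bilinear_simps cmul_diff)
lift_definition uminus_operator :: "'i operator \<Rightarrow> 'i operator" is uminus
proof safe
  fix T T' :: "'i ell2 \<Rightarrow>\<^sub>L 'i ell2"
  assume "adjoint_pair T T'"
  then show "\<exists>R. adjoint_pair (- T) R"
    by (intro exI[of _ "- T'"]) (simp add: adjoint_pair_def blinfun.bilinear_simps)
qed (simp add: complex_linear_def blinfun.bilinear_simps cmul_uminus)
lift_definition scaleR_operator :: "real \<Rightarrow> 'i operator \<Rightarrow> 'i operator" is scaleR
proof safe
  fix r and T T' :: "'i ell2 \<Rightarrow>\<^sub>L 'i ell2"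
  assume "adjoint_pair T T'"
  then show "\<exists>R. adjoint_pair (r *\<^sub>R T) R"
    by (intro exI[of _ "r *\<^sub>R T'"]) (simp add: adjoint_pair_def blinfun.bilinear_simps)
qed (simp add: complex_linear_def blinfun.bilinear_simps cmul_scaleR)
lift_definition times_operator :: "'i operator \<Rightarrow> 'i operator \<Rightarrow> 'i operator" is "(o\<^sub>L)"
proof safe
  fix S T S' T' :: "'i ell2 \<Rightarrow>\<^sub>L 'i ell2"
  assume "adjoint_pair S S'" "adjoint_pair T T'"
  then show "\<exists>R. adjoint_pair (S o\<^sub>L T) R"
    by (intro exI[of _ "T' o\<^sub>L S'"]) (simp add: adjoint_pair_def)
qed (simp add: complex_linear_def)
lift_definition norm_operator :: "'i operator \<Rightarrow> real" is norm .

definition dist_operator :: "'i operator \<Rightarrow> 'i operator \<Rightarrow> real" where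
  "dist_operator S T = norm (S - T)"
definition sgn_operator :: "'i operator \<Rightarrow> 'i operator" where
  "sgn_operator T = scaleR (inverse (norm T)) T"
definition uniformity_operator :: "('i operator \<times> 'i operator) filter" where
  "uniformity_operator = (INF e\<in>{0<..}. principal {(x, y). dist x y < e})"
definition open_operator :: "'i operator set \<Rightarrow> bool" where
  "open_operator S = (\<forall>x\<in>S. \<forall>\<^sub>F (x', y) in uniformity. x' = x \<longrightarrow> y \<in> S)"

instance
proof
  fix x y z :: "'i operator" and r s :: real
  show "x + y + z = x + (y + z)" "x + y = y + x" "0 + x = x" "- x + x = 0" "x - y = x + - y"
    "r *\<^sub>R (x + y) = r *\<^sub>R x + r *\<^sub>R y" "(r + s) *\<^sub>R x = r *\<^sub>R x + s *\<^sub>R x" "r *\<^sub>R s *\<^sub>R x = (r * s) *\<^sub>R x"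
    "1 *\<^sub>R x = x"
    by (transfer; simp add: algebra_simps)+
  show "x * y * z = x * (y * z)" "(x + y) * z = x * z + y * z" "x * (y + z) = x * y + x * z"
    "r *\<^sub>R x * y = r *\<^sub>R (x * y)" "x * r *\<^sub>R y = r *\<^sub>R (x * y)" "1 * x = x" "x * 1 = x"
    by (transfer; rule blinfun_eqI; simp add: blinfun.bilinear_simps)+
  show "(0 :: 'i operator) \<noteq> 1"
  proof transfer
    have "(0 :: 'i ell2 \<Rightarrow>\<^sub>L 'i ell2) (ket undefined) \<noteq> id_blinfun (ket undefined)"
      using norm_ket[of "undefined :: 'i"] by (metis blinfun.zero_left id_blinfun.rep_eq id_apply norm_zero zero_neq_one)
    then show "(0 :: 'i ell2 \<Rightarrow>\<^sub>L 'i ell2) \<noteq> id_blinfun" by metis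
  qed
  show "norm x = 0 \<longleftrightarrow> x = 0" "norm (x + y) \<le> norm x + norm y" "norm (r *\<^sub>R x) = \<bar>r\<bar> * norm x"
    by (transfer; simp add: norm_triangle_ineq)+
  show "norm (x * y) \<le> norm x * norm y"
    by transfer (rule norm_blinfun_compose)
  show "norm (1 :: 'i operator) = 1"
  proof transfer
    show "norm (id_blinfun :: 'i ell2 \<Rightarrow>\<^sub>L 'i ell2) = 1"
      by (rule norm_blinfun_eqI[where x = "ket undefined"]) auto
  qed
  show "dist x y = norm (x - y)" by (rule dist_operator_def)
  show "sgn x = scaleR (inverse (norm x)) x" by (rule sgn_operator_def)
  show "uniformity = (INF e\<in>{0<..}. principal {(x, y :: 'i operator). dist x y < e})"
    by (rule uniformity_operator_def)
  show "open U = (\<forall>x\<in>U. \<forall>\<^sub>F (x', y) in uniformity. x' = x \<longrightarrow> y \<in> U)" for U :: "'i operator set"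
    by (rule open_operator_def)
qed

end

instance operator :: (type) banach
proof
  fix X :: "nat \<Rightarrow> 'i operator"
  assume X: "Cauchy X"
  have norm_diff: "norm (blin (X m) - blin (X n)) = norm (X m - X n)" for m n
    by (simp add: norm_operator.rep_eq minus_operator.rep_eq)
  have "\<exists>X'. \<forall>n. adjoint_pair (blin (X n)) (X' n)"
    using blin by (intro choice) blast
  then obtain X' where X': "\<And>n. adjoint_pair (blin (X n)) (X' n)" by blast
  have "Cauchy (\<lambda>n. blin (X n))"
    using X unfolding Cauchy_iff norm_diff .
  \<comment> \<open>Taking adjoints is isometric, so the adjoints converge too; their limit
    witnesses that \<open>T\<close> has an adjoint.\<close>
  moreover have "Cauchy X'"
    using X unfolding Cauchy_iff norm_adjoint_pair[OF adjoint_pair_diff[OF X' X']] norm_diff .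
  ultimately obtain T T' where T: "(\<lambda>n. blin (X n)) \<longlonglongrightarrow> T" and T': "X' \<longlonglongrightarrow> T'"
    unfolding Cauchy_convergent_iff convergent_def by blast
  have *: "(\<lambda>n. blin (X n) f) \<longlonglongrightarrow> T f" "(\<lambda>n. X' n f) \<longlonglongrightarrow> T' f" for f
    using T T' by (auto intro: blinfun.tendsto)
  have cl: "complex_linear T"
    unfolding complex_linear_def
  proof (intro allI)
    fix c f
    have "(\<lambda>n. cmul_blinfun c (blin (X n) f)) \<longlonglongrightarrow> cmul_blinfun c (T f)"
      by (intro blinfun.tendsto tendsto_const *)
    moreover have "cmul_blinfun c (blin (X n) f) = blin (X n) (cmul c f)" for n
      using blin[of "X n"] by (simp add: complex_linear_def)
    ultimately show "T (cmul c f) = cmul c (T f)"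
      using LIMSEQ_unique[OF *(1)[of "cmul c f"]] by simp
  qed
  have "adjoint_pair T T'"
    unfolding adjoint_pair_def
  proof (intro allI)
    fix f g
    have "(\<lambda>n. blin (X n) f \<bullet> g) = (\<lambda>n. f \<bullet> X' n g)"
      using X' by (simp only: adjoint_pair_def)
    moreover have "(\<lambda>n. blin (X n) f \<bullet> g) \<longlonglongrightarrow> T f \<bullet> g" "(\<lambda>n. f \<bullet> X' n g) \<longlonglongrightarrow> f \<bullet> T' g"
      by (intro tendsto_inner tendsto_const *)+
    ultimately show "T f \<bullet> g = f \<bullet> T' g"
      by (simp only: LIMSEQ_unique)
  qed
  with cl have B: "blin (Operator T) = T" by (intro Operator_inverse) auto
  have "X \<longlonglongrightarrow> Operator T"
    using T unfolding LIMSEQ_iff by (simp add: norm_operator.rep_eq minus_operator.rep_eq B)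
  then show "convergent X" by (auto simp: convergent_def)
qed

section \<open>Complex scalars, involution and the C*-identity\<close>

abbreviation app :: "'i operator \<Rightarrow> 'i ell2 \<Rightarrow> 'i ell2" where
  "app T f \<equiv> blin T f"

lemma operator_eqI: "(\<And>f. app S f = app T f) \<Longrightarrow> S = T"
  by (metis blin_inject blinfun_eqI)

lemma app_simps [simp]:
  "app (S + T) f = app S f + app T f" "app (S - T) f = app S f - app T f"
  "app (- T) f = - app T f" "app 0 f = 0" "app 1 f = f" "app (S * T) f = app S (app T f)"
  "app (r *\<^sub>R T) f = r *\<^sub>R app T f"
  by (simp_all add: plus_operator.rep_eq minus_operator.rep_eq uminus_operator.rep_eq
      zero_operator.rep_eq one_operator.rep_eq times_operator.rep_eq scaleR_operator.rep_eq
      blinfun.bilinear_simps)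

lemma app_cmul: "app T (cmul c f) = cmul c (app T f)"
  using blin[of T] by (simp add: complex_linear_def)

lemma norm_app: "norm (app T f) \<le> norm T * norm f"
  unfolding norm_operator.rep_eq by (rule norm_blinfun)

lemma norm_operator_bound: "0 \<le> b \<Longrightarrow> (\<And>f. norm (app T f) \<le> b * norm f) \<Longrightarrow> norm T \<le> b"
  unfolding norm_operator.rep_eq by (rule norm_blinfun_bound)

lift_definition cscale :: "complex \<Rightarrow> 'i operator \<Rightarrow> 'i operator" is "\<lambda>c T. cmul_blinfun c o\<^sub>L T"
proof safe
  fix c and T T' :: "'i ell2 \<Rightarrow>\<^sub>L 'i ell2"
  assume "adjoint_pair T T'"
  then show "\<exists>R. adjoint_pair (cmul_blinfun c o\<^sub>L T) R"
    by (intro exI[of _ "T' o\<^sub>L cmul_blinfun (cnj c)"]) (simp add: adjoint_pair_def inner_cmul_left)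
qed (simp add: complex_linear_def cmul_cmul mult.commute)

lemma app_cscale [simp]: "app (cscale c T) f = cmul c (app T f)"
  by (simp add: cscale.rep_eq)

lift_definition star :: "'i operator \<Rightarrow> 'i operator" is "\<lambda>T. SOME T'. adjoint_pair T T'"
  by (metis (mono_tags, lifting) adjoint_pair_sym complex_linear_adjoint_pair someI_ex)

lemma inner_app_left: "app T f \<bullet> g = f \<bullet> app (star T) g"
proof -
  have "adjoint_pair (blin T) (blin (star T))"
    unfolding star.rep_eq using blin[of T] by (auto intro: someI)
  then show ?thesis by (simp add: adjoint_pair_def)
qed

lemma star_eqI:
  assumes "\<And>f g. app T f \<bullet> g = f \<bullet> app T' g"
  shows "star T = T'"
proof (rule operator_eqI)
  fix g
  have "f \<bullet> app (star T) g = f \<bullet> app T' g" for f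
    using assms[of f g] inner_app_left[of T f g] by simp
  then show "app (star T) g = app T' g" by (rule inner_eqI)
qed

lemma star_star: "star (star T) = T"
  by (rule star_eqI) (metis inner_app_left inner_commute)

lemma star_add: "star (S + T) = star S + star T"
  and star_mult: "star (S * T) = star T * star S"
  and star_cscale: "star (cscale c T) = cscale (cnj c) (star T)"
  and star_one: "star 1 = 1"
  by (rule star_eqI; simp add: inner_app_left inner_add_left inner_add_right inner_cmul_left app_cmul)+

lemma cscale_simps:
  "cscale c (S + T) = cscale c S + cscale c T" "cscale (c + d) T = cscale c T + cscale d T"
  "cscale c (cscale d T) = cscale (c * d) T" "cscale 1 T = T"
  "cscale c S * T = cscale c (S * T)" "S * cscale c T = cscale c (S * T)"
  "cscale (complex_of_real r) T = r *\<^sub>R T" "cscale c 0 = 0"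
  by (rule operator_eqI;
      simp add: cmul_add cmul_add_left cmul_cmul cmul_one app_cmul cmul_of_real cmul_zero)+

lemma norm_cscale: "norm (cscale c T) = cmod c * norm T"
proof -
  have le: "norm (cscale c T) \<le> cmod c * norm T" for c and T :: "'i operator"
  proof (rule norm_operator_bound)
    fix f
    show "norm (app (cscale c T) f) \<le> cmod c * norm T * norm f"
      using mult_left_mono[OF norm_app[of T f] norm_ge_zero[of c]] by (simp add: norm_cmul mult.assoc)
  qed simp
  show ?thesis
  proof (cases "c = 0")
    case True
    then show ?thesis using le[of c T] by simp
  next
    case False
    then have "norm T \<le> cmod (inverse c) * norm (cscale c T)"
      using le[of "inverse c" "cscale c T"] by (simp add: cscale_simps)
    then have "cmod c * norm T \<le> norm (cscale c T)"
      using False by (simp add: norm_inverse norm_divide field_simps)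
    then show ?thesis using le[of c T] by simp
  qed
qed

lemma bounded_linear_cscale: "bounded_linear (cscale c)"
  by (rule bounded_linear_intro[where K = "cmod c"])
    (simp_all add: cscale_simps norm_cscale mult.commute flip: cscale_simps(7))

lemma norm_star: "norm (star T) = norm T"
proof -
  have "adjoint_pair (blin T) (blin (star T))"
    by (simp add: adjoint_pair_def inner_app_left)
  then show ?thesis unfolding norm_operator.rep_eq by (rule norm_adjoint_pair)
qed

lemma bounded_linear_star: "bounded_linear star"
proof (rule bounded_linear_intro[where K = 1])
  show "star (r *\<^sub>R T) = r *\<^sub>R star T" for r and T :: "'i operator"
    using star_cscale[of "complex_of_real r" T] by (simp add: cscale_simps)
qed (simp_all add: star_add norm_star)

lemma norm_star_mult_self: "norm (star T * T) = (norm T)\<^sup>2"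
proof (rule antisym)
  show "norm (star T * T) \<le> (norm T)\<^sup>2"
    using norm_mult_ineq[of "star T" T] by (simp add: norm_star power2_eq_square)
  have "norm T \<le> sqrt (norm (star T * T))"
  proof (rule norm_operator_bound)
    fix f
    have "(norm (app T f))\<^sup>2 = f \<bullet> app (star T * T) f"
      by (simp add: inner_app_left dot_square_norm[symmetric])
    also have "\<dots> \<le> norm f * norm (app (star T * T) f)" by (rule norm_cauchy_schwarz)
    also have "\<dots> \<le> norm f * (norm (star T * T) * norm f)"
      by (intro mult_left_mono norm_app norm_ge_zero)
    also have "\<dots> = (sqrt (norm (star T * T)) * norm f)\<^sup>2"
      by (simp add: power_mult_distrib power2_eq_square)
    finally show "norm (app T f) \<le> sqrt (norm (star T * T)) * norm f"
      by (rule power2_le_imp_le) simp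
  qed simp
  then show "(norm T)\<^sup>2 \<le> norm (star T * T)"
    by (metis norm_ge_zero power_mono real_sqrt_pow2)
qed

section \<open>Unitaries from weighted permutations of the basis\<close>

lemma bounded_linear_weighted_composition:
  assumes w: "\<And>i. cmod (w i) = 1" and h: "bij h"
  obtains T :: "'i ell2 \<Rightarrow>\<^sub>L 'i ell2" where "\<And>f i. coord (T f) i = w i * coord f (h i)"
proof -
  define L where "L f = Ell2 (\<lambda>i. w i * coord f (h i))" for f
  have ss: "square_summable (\<lambda>i. w i * coord f (h i))" for f
    by (rule square_summable_mult[where C = 1, OF square_summable_reindex[OF square_summable_coord h]])
      (simp add: w)
  have L: "coord (L f) i = w i * coord f (h i)" for f i
    using ss[of f] by (simp only: L_def Ell2_inverse mem_Collect_eq)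
  have "bounded_linear L"
  proof (rule bounded_linear_intro[where K = 1])
    show "L (f + g) = L f + L g" "L (r *\<^sub>R f) = r *\<^sub>R L f" for f g r
      by (rule ell2_eqI; simp add: L algebra_simps)+
    fix f
    have "(norm (L f))\<^sup>2 = (\<Sum>\<^sub>\<infinity>i. (cmod (coord f (h i)))\<^sup>2)"
      unfolding norm_ell2_sq L by (simp add: norm_mult w)
    also have "\<dots> = (norm f)\<^sup>2"
      unfolding norm_ell2_sq by (rule infsum_reindex_bij_betw[OF h])
    finally show "norm (L f) \<le> norm f * 1"
      by (metis mult.right_neutral norm_ge_zero order_refl power2_le_imp_le)
  qed
  then have "coord (Blinfun L f) i = w i * coord f (h i)" for f i
    by (simp add: bounded_linear_Blinfun_apply L)
  then show ?thesis by (rule that)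
qed

text \<open>The adjoint is composition with the inverse permutation \<open>k\<close>, weighted by
  the conjugate phases moved along \<open>k\<close>; reindexing the inner product by
  \<open>h\<close> shows it.\<close>

lemma weighted_composition_operator:
  assumes w: "\<And>i. cmod (w i) = 1" and h: "bij h"
  obtains T :: "'i operator" where "\<And>f i. coord (app T f) i = w i * coord f (h i)"
    and "star T * T = 1"
proof -
  define k where "k = inv_into UNIV h"
  have inv: "k (h i) = i" for i using h by (simp add: k_def bij_is_inj)
  have k: "bij k" unfolding k_def by (rule bij_imp_bij_inv[OF h])
  obtain T :: "'i ell2 \<Rightarrow>\<^sub>L 'i ell2" where T: "\<And>f i. coord (T f) i = w i * coord f (h i)"
    using bounded_linear_weighted_composition[of w h] assms by blast
  obtain T' :: "'i ell2 \<Rightarrow>\<^sub>L 'i ell2"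
    where T': "\<And>f i. coord (T' f) i = cnj (w (k i)) * coord f (k i)"
    using bounded_linear_weighted_composition[of "\<lambda>i. cnj (w (k i))" k] w k
    by auto
  have cw: "cnj (w i) * w i = 1" for i
    using w[of i] complex_norm_square[of "w i"] by (simp add: mult.commute)
  have "adjoint_pair T T'"
    unfolding adjoint_pair_def
  proof (intro allI)
    fix f g
    have "T f \<bullet> g = (\<Sum>\<^sub>\<infinity>i. (w i * coord f (h i)) \<bullet> coord g i)"
      by (simp add: inner_ell2.rep_eq T)
    also have "\<dots> = (\<Sum>\<^sub>\<infinity>i. coord f (h i) \<bullet> (cnj (w (k (h i))) * coord g (k (h i))))"
      by (simp add: inv inner_complex_def algebra_simps)
    also have "\<dots> = (\<Sum>\<^sub>\<infinity>i. coord f i \<bullet> (cnj (w (k i)) * coord g (k i)))"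
      by (rule infsum_reindex_bij_betw[OF h])
    also have "\<dots> = f \<bullet> T' g" by (simp add: inner_ell2.rep_eq T')
    finally show "T f \<bullet> g = f \<bullet> T' g" .
  qed
  moreover have "complex_linear T"
    unfolding complex_linear_def by (intro allI ell2_eqI) (simp add: T)
  ultimately have B: "blin (Operator T) = T" by (intro Operator_inverse) auto
  have "adjoint_pair (blin (Operator T)) (blin (star (Operator T)))"
    by (simp add: adjoint_pair_def inner_app_left)
  with \<open>adjoint_pair T T'\<close> have "blin (star (Operator T)) = T'"
    unfolding B by (rule adjoint_pair_unique[rotated])
  moreover have "T' (T f) = f" for f
  proof (rule ell2_eqI)
    fix i
    have "h (k i) = i" using h by (simp add: k_def bij_is_surj surj_f_inv_f)
    then show "coord (T' (T f)) i = coord f i"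
      using cw[of "k i"] by (simp add: T T' flip: mult.assoc)
  qed
  ultimately have "star (Operator T) * Operator T = 1"
    by (intro operator_eqI) (simp add: B)
  then show ?thesis using that T B by metis
qed

text \<open>A diagonal matrix entry of \<open>star T * T\<close> is the squared norm of a column of
  \<open>T\<close>. Its imaginary part vanishes by \<open>inner_cmul_ii_self\<close>.\<close>

lemma coord_star_mult_self:
  fixes T :: "'i operator"
  shows "coord (app (star T * T) (ket j)) j = complex_of_real ((norm (app T (ket j)))\<^sup>2)"
proof (rule complex_eqI)
  let ?g = "app T (ket j) :: 'i ell2"
  have *: "coord (app (star T * T) (ket j)) j \<bullet> c = ?g \<bullet> cmul c ?g" for c
    using inner_app_left[of "star T" ?g "cmul c (ket j)"]
    by (simp add: star_star app_cmul inner_cmul_ket)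
  show "Re (coord (app (star T * T) (ket j)) j) = Re (complex_of_real ((norm ?g)\<^sup>2))"
    using *[of 1] by (simp add: inner_complex_def cmul_one dot_square_norm)
  show "Im (coord (app (star T * T) (ket j)) j) = Im (complex_of_real ((norm ?g)\<^sup>2))"
    using *[of \<i>] by (simp add: inner_complex_def inner_cmul_ii_self)
qed

lemma bounded_linear_coord_app:
  fixes f :: "'i ell2"
  shows "bounded_linear (\<lambda>T. coord (app T f) i)"
proof (rule bounded_linear_intro[where K = "norm f"])
  show "norm (coord (app T f) i) \<le> norm T * norm f" for T :: "'i operator"
    using cmod_coord_le[of "app T f" i] norm_app[of T f] by linarith
qed (simp_all add: scaleR_conv_of_real[where 'a = complex])

section \<open>Additivity of the trace of the logarithm\<close>

text \<open>The Neumann series of the inverse of 1 + a, which is the factor in the derivative of log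
  (1 + a).\<close>

definition inverse_series :: "'a::{real_normed_algebra_1,banach} \<Rightarrow> 'a" where
  "inverse_series a = (\<Sum>k. (- a) ^ k)"

lemma summable_neumann:
  fixes a :: "'a::{real_normed_algebra_1,banach}"
  assumes "norm a < 1"
  shows "summable (\<lambda>k. (- a) ^ k)"
proof (rule summable_comparison_test')
  show "summable (\<lambda>k. norm a ^ k)" using assms by (simp add: summable_geometric)
  show "norm ((- a) ^ k) \<le> norm a ^ k" for k
    using norm_power_ineq[of "- a" k] by simp
qed

lemma inverse_series_inverse:
  fixes a :: "'a::{real_normed_algebra_1,banach}"
  assumes "norm a < 1"
  shows "inverse_series a * (1 + a) = 1" "(1 + a) * inverse_series a = 1"
proof -
  let ?s = "\<lambda>k. (- a) ^ k"
  have sums: "?s sums inverse_series a"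
    using summable_neumann[OF assms] by (simp add: inverse_series_def summable_sums)
  have tail: "(\<lambda>k. ?s (Suc k)) sums (inverse_series a - 1)"
    using sums by (subst sums_Suc_iff) simp
  have "(\<lambda>k. ?s k * (- a)) sums (inverse_series a * (- a))"
    by (rule sums_mult2[OF sums])
  then have "inverse_series a * (- a) = inverse_series a - 1"
    using tail by (metis (no_types, lifting) power_Suc2 sums_unique2 sums_cong)
  then show "inverse_series a * (1 + a) = 1" by (simp add: algebra_simps)
  have "(\<lambda>k. - a * ?s k) sums (- a * inverse_series a)"
    by (rule sums_mult[OF sums])
  then have "- a * inverse_series a = inverse_series a - 1"
    using tail by (metis (no_types, lifting) power_Suc sums_unique2 sums_cong)
  then show "(1 + a) * inverse_series a = 1" by (simp add: algebra_simps)
qed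

text \<open>\<open>c t\<close> and \<open>c'\<close> need not commute, so the Leibniz rule keeps
  \<open>c'\<close> in each of the k positions.\<close>

lemma has_vector_derivative_power:
  fixes c :: "real \<Rightarrow> 'a::real_normed_algebra_1"
  assumes "(c has_vector_derivative c') (at t within S)"
  shows "((\<lambda>t. c t ^ k) has_vector_derivative (\<Sum>i<k. c t ^ i * c' * c t ^ (k - Suc i))) (at t within S)"
proof (induction k)
  case 0
  show ?case by simp
next
  case (Suc k)
  have "c t ^ k * c' + (\<Sum>i<k. c t ^ i * c' * c t ^ (k - Suc i)) * c t =
      (\<Sum>i<Suc k. c t ^ i * c' * c t ^ (Suc k - Suc i))"
  proof -
    have "(\<Sum>i<k. c t ^ i * c' * c t ^ (k - Suc i)) * c t = (\<Sum>i<k. c t ^ i * c' * c t ^ (Suc k - Suc i))"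
      unfolding sum_distrib_right
    proof (rule sum.cong[OF refl])
      fix i assume "i \<in> {..<k}"
      then have "Suc k - Suc i = Suc (k - Suc i)" by auto
      then show "c t ^ i * c' * c t ^ (k - Suc i) * c t = c t ^ i * c' * c t ^ (Suc k - Suc i)"
        by (simp only: power_Suc2 mult.assoc)
    qed
    then show ?thesis by simp
  qed
  then show ?case
    using has_vector_derivative_mult[OF Suc.IH assms] by (simp add: power_commutes add.commute)
qed

text \<open>The functional is real because it will be the imaginary part of a complex trace. It is
  bounded on the whole algebra but symmetric on \<open>A\<close> only.\<close>

locale tracial_subalgebra =
  fixes A :: "'a::{real_normed_algebra_1,banach} set" and \<tau> :: "'a \<Rightarrow> real"
  assumes subspace: "subspace A" and one_mem: "1 \<in> A" and closed: "closed A"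
    and mult_mem: "\<And>x y. x \<in> A \<Longrightarrow> y \<in> A \<Longrightarrow> x * y \<in> A"
    and bounded_linear_trace: "bounded_linear \<tau>"
    and tracial: "\<And>x y. x \<in> A \<Longrightarrow> y \<in> A \<Longrightarrow> \<tau> (x * y) = \<tau> (y * x)"
begin

lemma add_mem: "x \<in> A \<Longrightarrow> y \<in> A \<Longrightarrow> x + y \<in> A"
  and scaleR_mem: "x \<in> A \<Longrightarrow> r *\<^sub>R x \<in> A"
  and uminus_mem: "x \<in> A \<Longrightarrow> - x \<in> A"
  using subspace by (auto simp: subspace_add subspace_scale subspace_neg)

lemma power_mem: "x \<in> A \<Longrightarrow> x ^ k \<in> A"
  by (induction k) (auto intro: one_mem mult_mem)

text \<open>Cyclic permutation under \<open>\<tau>\<close> is confined to \<open>A\<close>, so the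
  inverses that are to be moved around must lie there; \<open>A\<close> is closed for this
  purpose.\<close>

lemma inverse_series_mem:
  assumes "x \<in> A" "norm x < 1"
  shows "inverse_series x \<in> A"
proof (rule closed_sequentially[OF closed])
  show "(\<lambda>n. \<Sum>k<n. (- x) ^ k) \<longlonglongrightarrow> inverse_series x"
    using summable_neumann[OF assms(2)] by (simp add: inverse_series_def summable_LIMSEQ)
  show "(\<Sum>k<n. (- x) ^ k) \<in> A" for n
    using assms(1) subspace by (intro subspace_sum power_mem uminus_mem)
qed

text \<open>This is \<open>\<tau>\<close> of log (1 + a), expanded termwise into a series of real
  numbers; the argument is the deviation from 1.\<close>

definition trace_log :: "'a \<Rightarrow> real" where
  "trace_log a = (\<Sum>k. (-1) ^ k / (real k + 1) * \<tau> (a ^ Suc k))"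

lemma trace_log_0: "trace_log 0 = 0"
proof -
  interpret \<tau>: bounded_linear \<tau> by (rule bounded_linear_trace)
  show ?thesis by (simp add: trace_log_def \<tau>.zero)
qed

lemma trace_bound:
  obtains K where "K > 0" "\<And>x. \<bar>\<tau> x\<bar> \<le> norm x * K"
  using bounded_linear.pos_bounded[OF bounded_linear_trace] by auto

text \<open>Under the trace the k + 1 Leibniz terms of the power k + 1 become equal, and their
  number cancels the coefficient 1 / (k + 1) of the logarithm.\<close>

lemma trace_power_derivative:
  assumes "(c has_vector_derivative c') (at t within S)" "c t \<in> A" "c' \<in> A"
  shows "((\<lambda>t. (-1) ^ k / (real k + 1) * \<tau> (c t ^ Suc k)) has_field_derivative \<tau> ((- c t) ^ k * c'))
    (at t within S)"
proof -
  interpret \<tau>: bounded_linear \<tau> by (rule bounded_linear_trace)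
  have "\<tau> (c t ^ i * c' * c t ^ (Suc k - Suc i)) = \<tau> (c t ^ k * c')" if "i < Suc k" for i
  proof -
    have "\<tau> (c t ^ i * c' * c t ^ (k - i)) = \<tau> (c t ^ (k - i) * (c t ^ i * c'))"
      using assms by (intro tracial mult_mem power_mem)
    also have "c t ^ (k - i) * (c t ^ i * c') = c t ^ k * c'"
      using that by (simp add: power_add[symmetric] mult.assoc[symmetric])
    finally show ?thesis by simp
  qed
  then have "\<tau> (\<Sum>i<Suc k. c t ^ i * c' * c t ^ (Suc k - Suc i)) = (real k + 1) * \<tau> (c t ^ k * c')"
    unfolding \<tau>.sum by simp
  then have "((\<lambda>t. \<tau> (c t ^ Suc k)) has_vector_derivative (real k + 1) * \<tau> (c t ^ k * c')) (at t within S)"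
    using \<tau>.has_vector_derivative[OF has_vector_derivative_power[OF assms(1)], of "Suc k"] by simp
  then have "((\<lambda>t. (-1) ^ k / (real k + 1) * \<tau> (c t ^ Suc k)) has_field_derivative
      (-1) ^ k / (real k + 1) * ((real k + 1) * \<tau> (c t ^ k * c'))) (at t within S)"
    unfolding has_real_derivative_iff_has_vector_derivative[symmetric] by (rule DERIV_cmult)
  moreover have "(-1) ^ k / (real k + 1) * ((real k + 1) * \<tau> (c t ^ k * c')) = \<tau> ((- c t) ^ k * c')"
  proof -
    have "(- c t) ^ k * c' = (-1) ^ k *\<^sub>R (c t ^ k * c')"
      by (cases "even k") simp_all
    then show ?thesis by (simp add: \<tau>.scaleR)
  qed
  ultimately show ?thesis by simp
qed

text \<open>The termwise derivatives are the Neumann series of \<open>c t\<close> applied to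
  \<open>c' t\<close> under the trace; they converge uniformly by comparison with a geometric series
  of ratio \<open>r\<close>. The condition \<open>c 0 = 0\<close> provides the point at which the
  series itself converges, as termwise differentiation demands.\<close>

lemma trace_log_derivative:
  assumes deriv: "\<And>t. t \<in> {0..1} \<Longrightarrow> (c has_vector_derivative c' t) (at t within {0..1})"
    and mem: "\<And>t. t \<in> {0..1} \<Longrightarrow> c t \<in> A" "\<And>t. t \<in> {0..1} \<Longrightarrow> c' t \<in> A"
    and le: "\<And>t. t \<in> {0..1} \<Longrightarrow> norm (c t) \<le> r" "r < 1"
    and le': "\<And>t. t \<in> {0..1} \<Longrightarrow> norm (c' t) \<le> M"
    and "c 0 = 0" and t: "t \<in> {0..1}"
  shows "((\<lambda>t. trace_log (c t)) has_field_derivative \<tau> (inverse_series (c t) * c' t)) (at t within {0..1})"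
proof -
  interpret \<tau>: bounded_linear \<tau> by (rule bounded_linear_trace)
  let ?f = "\<lambda>k t. (-1) ^ k / (real k + 1) * \<tau> (c t ^ Suc k)" and ?f' = "\<lambda>k t. \<tau> ((- c t) ^ k * c' t)"
  obtain K where K: "K > 0" "\<And>x. \<bar>\<tau> x\<bar> \<le> norm x * K" using trace_bound by blast
  have "0 \<le> r" using le(1)[of 0] \<open>c 0 = 0\<close> by simp
  have sums: "(\<lambda>k. ?f' k t) sums \<tau> (inverse_series (c t) * c' t)" if "t \<in> {0..1}" for t
    using summable_neumann[of "c t"] le(1)[OF that] le(2)
    by (intro \<tau>.sums sums_mult2) (simp add: inverse_series_def summable_sums)
  have "uniform_limit {0..1} (\<lambda>n t. \<Sum>k<n. ?f' k t) (\<lambda>t. \<Sum>k. ?f' k t) sequentially"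
  proof (rule Weierstrass_m_test)
    show "summable (\<lambda>k. r ^ k * M * K)"
      using \<open>0 \<le> r\<close> le(2) by (intro summable_mult2 summable_geometric) simp
    fix k t assume t: "t \<in> {0..1::real}"
    have "norm ((- c t) ^ k * c' t) \<le> norm (c t) ^ k * norm (c' t)"
      using norm_mult_ineq[of "(- c t) ^ k" "c' t"] norm_power_ineq[of "- c t" k]
      by (simp add: mult_right_mono order_trans)
    also have "\<dots> \<le> r ^ k * M"
      using le(1)[OF t] le'[OF t] by (intro mult_mono power_mono) (auto simp: \<open>0 \<le> r\<close>)
    finally have "norm ((- c t) ^ k * c' t) * K \<le> r ^ k * M * K" using K(1) by simp
    then show "norm (?f' k t) \<le> r ^ k * M * K" using K(2)[of "(- c t) ^ k * c' t"] by simp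
  qed
  then have ul: "uniform_limit {0..1} (\<lambda>n t. \<Sum>k<n. ?f' k t) (\<lambda>t. \<tau> (inverse_series (c t) * c' t)) sequentially"
    by (rule uniform_limit_cong[THEN iffD1, rotated 2]) (use sums in \<open>auto simp: sums_iff\<close>)
  have "\<exists>g. \<forall>t\<in>{0..1}. (\<lambda>k. ?f k t) sums g t \<and>
      (g has_field_derivative \<tau> (inverse_series (c t) * c' t)) (at t within {0..1})"
  proof (rule has_field_derivative_series[OF _ _ ul])
    show "(?f k has_field_derivative ?f' k t) (at t within {0..1})" if "t \<in> {0..1}" for k t
      using that by (intro trace_power_derivative deriv mem)
    show "summable (\<lambda>k. ?f k 0)" by (simp add: \<open>c 0 = 0\<close> \<tau>.zero)
  qed auto
  then obtain g where g: "\<And>t. t \<in> {0..1} \<Longrightarrow> (\<lambda>k. ?f k t) sums g t"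
    "\<And>t. t \<in> {0..1} \<Longrightarrow> (g has_field_derivative \<tau> (inverse_series (c t) * c' t)) (at t within {0..1})"
    by blast
  have "trace_log (c t) = g t" if "t \<in> {0..1}" for t
    using g(1)[OF that] by (simp add: trace_log_def sums_iff)
  then show ?thesis
    using g(2)[OF t] t by (subst has_field_derivative_cong_eventually[of _ g]) (auto simp: eventually_at_filter)
qed

text \<open>Along the path \<open>(1 + t a)(1 + t b)\<close> the logarithmic derivative of the product is the sum of the
  logarithmic derivatives of the factors, up to commutators.\<close>

theorem trace_log_mult:
  assumes a: "a \<in> A" "norm a \<le> 1/4" and b: "b \<in> A" "norm b \<le> 1/4"
  shows "trace_log ((1 + a) * (1 + b) - 1) = trace_log a + trace_log b"
proof -
  interpret \<tau>: bounded_linear \<tau> by (rule bounded_linear_trace)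
  define c where "c t = t *\<^sub>R a + t *\<^sub>R b + (t * t) *\<^sub>R (a * b)" for t
  define c' where "c' t = a + b + (2 * t) *\<^sub>R (a * b)" for t
  have ab: "norm (a * b) \<le> 1/4 * (1/4)"
    by (rule order_trans[OF norm_mult_ineq]) (intro mult_mono a b; simp)
  have small: "norm (t *\<^sub>R x) \<le> 1/4" if "t \<in> {0..1}" "norm x \<le> 1/4" for t and x :: 'a
    using mult_mono[of t 1 "norm x" "1/4"] that by simp
  have mem: "c t \<in> A" "c' t \<in> A" for t
    using a b by (auto simp: c_def c'_def intro!: add_mem scaleR_mem mult_mem)
  have dc: "(c has_vector_derivative c' t) (at t within S)" for t S
    unfolding c_def c'_def
    by (auto intro!: derivative_eq_intros simp: algebra_simps)
  have dl: "((\<lambda>t. t *\<^sub>R x) has_vector_derivative x) (at t within S)" for t S and x :: 'a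
    by (auto intro!: derivative_eq_intros)
  \<comment> \<open>Origin of the bound 1/4: each of the three terms of \<open>c t\<close> stays
    below 1/4, so the whole path remains in the ball of radius 3/4, inside the domain of the
    series.\<close>
  have norm_c: "norm (c t) \<le> 3/4" if t: "t \<in> {0..1}" for t
  proof -
    have "norm ((t * t) *\<^sub>R (a * b)) \<le> 1/4"
      using t ab by (intro small) (auto intro: mult_le_one)
    moreover have "norm (c t) \<le> norm (t *\<^sub>R a) + norm (t *\<^sub>R b) + norm ((t * t) *\<^sub>R (a * b))"
      unfolding c_def by (intro norm_triangle_le add_mono order_refl)
    ultimately show ?thesis using small[OF t a(2)] small[OF t b(2)] by linarith
  qed
  have norm_c': "norm (c' t) \<le> 1" if t: "t \<in> {0..1}" for t
  proof -
    have "norm ((2 * t) *\<^sub>R (a * b)) \<le> 2 * (1/4 * (1/4))"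
      using t ab mult_mono[of "2 * t" 2 "norm (a * b)" "1/4 * (1/4)"] by simp
    moreover have "norm (c' t) \<le> norm a + norm b + norm ((2 * t) *\<^sub>R (a * b))"
      unfolding c'_def by (intro norm_triangle_le add_mono order_refl)
    ultimately show ?thesis using a b by linarith
  qed
  let ?F = "\<lambda>t. trace_log (c t) - (trace_log (t *\<^sub>R a) + trace_log (t *\<^sub>R b))"
  have "(?F has_field_derivative 0) (at t within {0..1})" if t: "t \<in> {0..1}" for t
  proof -
    let ?Ra = "inverse_series (t *\<^sub>R a)" and ?Rb = "inverse_series (t *\<^sub>R b)" and ?Rc = "inverse_series (c t)"
    have lt: "norm (t *\<^sub>R a) < 1" "norm (t *\<^sub>R b) < 1" "norm (c t) < 1"
      using small[OF t a(2)] small[OF t b(2)] norm_c[OF t] by linarith+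
    have Rmem: "?Ra \<in> A" "?Rb \<in> A"
      using lt a b by (auto intro!: inverse_series_mem scaleR_mem)
    have fac: "1 + c t = (1 + t *\<^sub>R a) * (1 + t *\<^sub>R b)"
      by (simp add: c_def algebra_simps)
    \<comment> \<open>\<open>?Rb * ?Ra\<close> inverts 1 + c t from the left and \<open>?Rc\<close>
      from the right, hence they agree.\<close>
    have "?Rc = ?Rb * ?Ra * ((1 + t *\<^sub>R a) * (1 + t *\<^sub>R b)) * ?Rc"
    proof -
      have "?Rb * ?Ra * ((1 + t *\<^sub>R a) * (1 + t *\<^sub>R b)) = ?Rb * (?Ra * (1 + t *\<^sub>R a)) * (1 + t *\<^sub>R b)"
        by (simp only: mult.assoc)
      also have "\<dots> = 1"
        by (simp only: inverse_series_inverse(1)[OF lt(1)] inverse_series_inverse(1)[OF lt(2)] mult_1_right)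
      finally show ?thesis by simp
    qed
    also have "\<dots> = ?Rb * ?Ra * ((1 + c t) * ?Rc)" by (simp only: fac mult.assoc)
    finally have Rc: "?Rc = ?Rb * ?Ra" using inverse_series_inverse(2)[OF lt(3)] by simp
    have c'_eq: "c' t = a * (1 + t *\<^sub>R b) + (1 + t *\<^sub>R a) * b"
      by (simp add: c'_def algebra_simps scaleR_2[symmetric])
    have "?Rc * c' t = ?Rb * (?Ra * a * (1 + t *\<^sub>R b)) + ?Rb * (?Ra * (1 + t *\<^sub>R a)) * b"
      unfolding Rc c'_eq by (subst distrib_left) (simp only: mult.assoc)
    also have "\<dots> = ?Rb * (?Ra * a * (1 + t *\<^sub>R b)) + ?Rb * b"
      by (simp only: inverse_series_inverse(1)[OF lt(1)] mult_1_right)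
    finally have "\<tau> (?Rc * c' t) = \<tau> (?Rb * (?Ra * a * (1 + t *\<^sub>R b))) + \<tau> (?Rb * b)"
      by (simp only: \<tau>.add)
    \<comment> \<open>Cyclicity carries \<open>?Rb\<close> to the right end, where it cancels
      against its inverse.\<close>
    also have "\<tau> (?Rb * (?Ra * a * (1 + t *\<^sub>R b))) = \<tau> (?Ra * a * (1 + t *\<^sub>R b) * ?Rb)"
      using Rmem a b by (intro tracial mult_mem add_mem scaleR_mem one_mem)
    also have "?Ra * a * (1 + t *\<^sub>R b) * ?Rb = ?Ra * a"
      by (simp only: mult.assoc inverse_series_inverse(2)[OF lt(2)] mult_1_right)
    finally have eq: "\<tau> (?Rc * c' t) - (\<tau> (?Ra * a) + \<tau> (?Rb * b)) = 0" by simp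
    have "((\<lambda>t. trace_log (c t)) has_field_derivative \<tau> (?Rc * c' t)) (at t within {0..1})"
      by (rule trace_log_derivative[OF dc mem norm_c _ norm_c' _ t]) (auto simp: c_def)
    moreover have "((\<lambda>t. trace_log (t *\<^sub>R x)) has_field_derivative \<tau> (inverse_series (t *\<^sub>R x) * x)) (at t within {0..1})"
      if x: "x \<in> A" "norm x \<le> 1/4" for x
      by (rule trace_log_derivative[where c' = "\<lambda>_. x", OF dl _ _ small[OF _ x(2)] _ _ _ t])
        (use x in \<open>auto intro: scaleR_mem\<close>)
    ultimately have "(?F has_field_derivative (\<tau> (?Rc * c' t) - (\<tau> (?Ra * a) + \<tau> (?Rb * b)))) (at t within {0..1})"
      using a b by (intro DERIV_diff DERIV_add)
    then show ?thesis unfolding eq .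
  qed
  then have "\<exists>k. \<forall>t\<in>{0..1}. ?F t = k"
    by (intro has_field_derivative_zero_constant) simp_all
  then obtain k where "\<And>t. t \<in> {0..1} \<Longrightarrow> ?F t = k" by blast
  \<comment> \<open>At time 0 all three logarithms are 0, so the constant is 0; time 1 is the
    claim.\<close>
  from this[of 0] this[of 1] have "trace_log (c 1) = trace_log a + trace_log b"
    by (simp add: c_def trace_log_0)
  then show ?thesis by (simp add: c_def algebra_simps)
qed

end

section \<open>Separable operator algebras as records over sequences\<close>

locale separable_operator_algebra =
  fixes D S :: "'i operator set"
  assumes countable: "countable D" and closure: "S = closure D"
    and one_mem: "1 \<in> S"
    and add_mem: "\<And>x y. x \<in> S \<Longrightarrow> y \<in> S \<Longrightarrow> x + y \<in> S"
    and mult_mem: "\<And>x y. x \<in> S \<Longrightarrow> y \<in> S \<Longrightarrow> x * y \<in> S"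
    and cscale_mem: "\<And>c x. x \<in> S \<Longrightarrow> cscale c x \<in> S"
    and star_mem: "\<And>x. x \<in> S \<Longrightarrow> star x \<in> S"
begin

lemma scaleR_mem: "x \<in> S \<Longrightarrow> r *\<^sub>R x \<in> S"
  using cscale_mem[of x "complex_of_real r"] by (simp add: cscale_simps)

lemma uminus_mem: "x \<in> S \<Longrightarrow> - x \<in> S"
  using scaleR_mem[of x "-1"] by simp

lemma zero_mem: "0 \<in> S"
  using scaleR_mem[OF one_mem, of 0] by simp

lemma diff_mem: "x \<in> S \<Longrightarrow> y \<in> S \<Longrightarrow> x - y \<in> S"
  using add_mem[of x "- y"] uminus_mem by simp

definition code :: "'i operator \<Rightarrow> nat \<Rightarrow> complex" where
  "code x = (\<lambda>n. complex_of_real (dist x (from_nat_into D n)))"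

lemma inj_on_code: "inj_on code S"
proof (rule inj_onI)
  fix x y assume x: "x \<in> S" and y: "y \<in> S" and eq: "code x = code y"
  have dist_eq: "dist x q = dist y q" if "q \<in> D" for q
    using fun_cong[OF eq, of "to_nat_on D q"] that countable by (simp add: code_def)
  have "dist x y \<le> e" if "e > 0" for e
  proof -
    obtain q where "q \<in> D" "dist q x < e / 2"
      using x \<open>e > 0\<close> unfolding closure closure_approachable by (meson half_gt_zero)
    then show ?thesis
      using dist_eq[of q] dist_triangle2[of x y q] by (simp add: dist_commute)
  qed
  then show "x = y" by (metis dense_le_bounded dist_le_zero_iff field_le_epsilon add_0)
qed

definition decode :: "(nat \<Rightarrow> complex) \<Rightarrow> 'i operator" where
  "decode = inv_into S code"

lemma decode_code [simp]: "x \<in> S \<Longrightarrow> decode (code x) = x"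
  by (simp add: decode_def inj_on_code)

text \<open>Every operation passes through \<open>decode\<close>, which inverts \<open>code\<close>
  on \<open>S\<close> only; hence the membership premises in \<open>coded_simps\<close>.\<close>

definition coded_algebra :: "(nat \<Rightarrow> complex) cstar_struct" where
  "coded_algebra = \<lparr>carrier = code ` S, monoid.mult = (\<lambda>x y. code (decode x * decode y)), one = code 1,
     zero = code 0, add = (\<lambda>x y. code (decode x + decode y)),
     smult = (\<lambda>c x. code (cscale c (decode x))), adj = (\<lambda>x. code (star (decode x))),
     cnorm = (\<lambda>x. norm (decode x))\<rparr>"

abbreviation "B \<equiv> coded_algebra"

lemma coded_simps [simp]:
  "carrier B = code ` S"
  "\<one>\<^bsub>B\<^esub> = code 1" "\<zero>\<^bsub>B\<^esub> = code 0"
  "x \<in> S \<Longrightarrow> y \<in> S \<Longrightarrow> code x \<otimes>\<^bsub>B\<^esub> code y = code (x * y)"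
  "x \<in> S \<Longrightarrow> y \<in> S \<Longrightarrow> code x \<oplus>\<^bsub>B\<^esub> code y = code (x + y)"
  "x \<in> S \<Longrightarrow> c \<odot>\<^bsub>B\<^esub> code x = code (cscale c x)"
  "x \<in> S \<Longrightarrow> adj B (code x) = code (star x)"
  "x \<in> S \<Longrightarrow> cnorm B (code x) = norm x"
  by (simp_all add: coded_algebra_def)

lemmas mem = one_mem zero_mem add_mem mult_mem cscale_mem star_mem uminus_mem diff_mem

section \<open>C*-axioms, completeness and separability of the coded algebra\<close>

lemma ring_coded: "ring B"
proof (rule ringI)
  show "abelian_group B"
  proof (rule abelian_groupI)
    fix x assume "x \<in> carrier B"
    then obtain a where "a \<in> S" "x = code a" by auto
    then show "\<exists>y\<in>carrier B. y \<oplus>\<^bsub>B\<^esub> x = \<zero>\<^bsub>B\<^esub>"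
      by (intro bexI[of _ "code (- a)"]) (auto simp: mem)
  qed (auto simp: mem add_ac)
  show "Group.monoid B"
    by (rule monoidI) (auto simp: mem mult.assoc)
qed (auto simp: mem algebra_simps)

lemma minus_coded:
  assumes "x \<in> S" "y \<in> S"
  shows "code x \<ominus>\<^bsub>B\<^esub> code y = code (x - y)"
proof -
  interpret ring B by (rule ring_coded)
  have "\<ominus>\<^bsub>B\<^esub> code y = code (- y)"
    by (rule minus_equality) (use assms in \<open>auto simp: mem\<close>)
  then show ?thesis using assms by (simp add: a_minus_def mem)
qed

lemma cdist_coded: "x \<in> S \<Longrightarrow> y \<in> S \<Longrightarrow> cdist B (code x) (code y) = dist x y"
  by (simp add: cdist_def minus_coded mem dist_norm)

lemma metric_coded: "Metric_space (carrier B) (cdist B)"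
proof
  fix x y
  show "0 \<le> cdist B x y" "cdist B x y = cdist B y x"
    by (cases "x \<in> carrier B \<and> y \<in> carrier B"; auto simp: cdist_coded dist_commute;
        auto simp: cdist_def minus_coded mem norm_minus_commute)+
next
  fix x y z assume "x \<in> carrier B" "y \<in> carrier B"
  then show "cdist B x y = 0 \<longleftrightarrow> x = y"
    by (auto simp: cdist_coded)
  assume "z \<in> carrier B"
  with \<open>x \<in> carrier B\<close> \<open>y \<in> carrier B\<close> show "cdist B x z \<le> cdist B x y + cdist B y z"
    by (auto simp: cdist_coded dist_triangle)
qed

lemma complete_coded: "Metric_space.mcomplete (carrier B) (cdist B)"
proof -
  interpret M: Metric_space "carrier B" "cdist B" by (rule metric_coded)
  show ?thesis
    unfolding M.mcomplete_def
  proof (intro allI impI)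
    fix \<sigma> assume "M.MCauchy \<sigma>"
    then have ran: "range \<sigma> \<subseteq> code ` S"
      and Cauchy: "\<And>e. e > 0 \<Longrightarrow> \<exists>N. \<forall>m n. N \<le> m \<longrightarrow> N \<le> n \<longrightarrow> cdist B (\<sigma> m) (\<sigma> n) < e"
      unfolding M.MCauchy_def by auto
    define X where "X n = decode (\<sigma> n)" for n
    have X: "X n \<in> S" "\<sigma> n = code (X n)" for n
    proof -
      obtain x where "x \<in> S" "\<sigma> n = code x" using ran by auto
      then show "X n \<in> S" "\<sigma> n = code (X n)" by (simp_all add: X_def)
    qed
    have "Cauchy X"
      using Cauchy unfolding Cauchy_def X(2) cdist_coded[OF X(1) X(1)] by meson
    then obtain l where l: "X \<longlonglongrightarrow> l"
      using Cauchy_convergent_iff convergent_def by blast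
    have "l \<in> S"
      by (rule closed_sequentially[OF _ X(1) l]) (simp add: closure)
    have "limitin M.mtopology \<sigma> (code l) sequentially"
      unfolding M.limitin_metric_dist_null X(2)
      using \<open>l \<in> S\<close> X(1) l by (simp add: cdist_coded tendsto_dist_iff[symmetric])
    then show "\<exists>x. limitin M.mtopology \<sigma> x sequentially" by blast
  qed
qed

lemma separable_coded: "separable_cstar B"
proof -
  interpret M: Metric_space "carrier B" "cdist B" by (rule metric_coded)
  have "D \<subseteq> S" by (simp add: closure closure_subset)
  have "\<exists>y\<in>code ` D. y \<in> M.mball (code x) r" if x: "x \<in> S" and r: "r > 0" for x r
  proof -
    obtain q where "q \<in> D" "dist q x < r"
      using x r unfolding closure closure_approachable by blast
    then show ?thesis
      using x \<open>D \<subseteq> S\<close> unfolding Bex_def M.in_mball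
      by (intro exI[of _ "code q"]) (auto simp: cdist_coded dist_commute)
  qed
  then have "M.mtopology closure_of (code ` D) = carrier B"
    unfolding M.metric_closure_of by auto
  then show ?thesis
    unfolding separable_cstar_def separable_space_def M.topspace_mtopology
    using countable \<open>D \<subseteq> S\<close> by (intro exI[of _ "code ` D"]) auto
qed

lemma unital_cstar_algebra_coded: "unital_cstar_algebra B"
proof -
  interpret ring B by (rule ring_coded)
  have "cring complex_field"
    by (rule cringI, rule abelian_groupI, auto simp: complex_field_def algebra_simps intro!: comm_monoidI)
      (metis add.commute add.right_inverse)
  then have "module complex_field B"
    by (intro module.intro abelian_group_axioms module_axioms.intro)
      (auto simp: complex_field_def mem cscale_simps)
  then show ?thesis
    by (intro unital_cstar_algebra.intro unital_cstar_algebra_axioms.intro ring_coded complete_coded)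
      (auto simp: mem cscale_simps star_star star_add star_cscale star_mult norm_cscale
        norm_triangle_ineq norm_mult_ineq norm_star_mult_self)
qed

text \<open>The functional intended here is a vector state on all operators, which is symmetric only
  on the algebra \<open>S\<close>; hence the different ranges of the premises.\<close>

lemma coded_in_separable_tracial_algebras:
  fixes \<tau> :: "'i operator \<Rightarrow> complex"
  assumes "\<And>x y. \<tau> (x + y) = \<tau> x + \<tau> y" "\<And>c x. \<tau> (cscale c x) = c * \<tau> x"
    and "\<And>x. \<tau> (star x * x) \<in> \<real>\<^sub>\<ge>\<^sub>0" "\<tau> 1 = 1"
    and "\<And>x y. x \<in> S \<Longrightarrow> y \<in> S \<Longrightarrow> \<tau> (x * y) = \<tau> (y * x)"
  shows "B \<in> separable_tracial_algebras"
proof -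
  have "tracial_state B (\<lambda>x. \<tau> (decode x))"
    unfolding tracial_state_def using assms(1-4) by (auto simp: mem intro!: assms(5))
  then show ?thesis
    unfolding separable_tracial_algebras_def
    using unital_cstar_algebra_coded separable_coded by auto
qed

lemma carrier_unitary_group_coded:
  "carrier (unitary_group B) = code ` {u \<in> S. star u * u = 1 \<and> u * star u = 1}"
proof -
  have "code x = code 1 \<longleftrightarrow> x = 1" if "x \<in> S" for x
    using inj_on_code that one_mem by (auto dest: inj_onD)
  then show ?thesis
    unfolding unitary_group_def by (auto simp: mem)
qed

end

section \<open>Twisted group algebras\<close>

text \<open>Extends the operations of a dense subalgebra, and identities between continuous
  expressions, to the closure. Unary operations enter as binary ones that ignore their second
  argument.\<close>

lemma closure_binary_image:
  fixes f :: "'a::metric_space \<Rightarrow> 'a \<Rightarrow> 'b::metric_space"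
  assumes "\<And>x y. x \<in> M \<Longrightarrow> y \<in> M \<Longrightarrow> f x y \<in> N"
    and "\<And>X Y x y. X \<longlonglongrightarrow> x \<Longrightarrow> Y \<longlonglongrightarrow> y \<Longrightarrow> (\<lambda>n. f (X n) (Y n)) \<longlonglongrightarrow> f x y"
    and "x \<in> closure M" "y \<in> closure M"
  shows "f x y \<in> closure N"
proof -
  obtain X Y where "\<And>n. X n \<in> M" "X \<longlonglongrightarrow> x" "\<And>n. Y n \<in> M" "Y \<longlonglongrightarrow> y"
    using assms(3,4) unfolding closure_sequential by blast
  then show ?thesis
    using assms(1,2) unfolding closure_sequential by (intro exI[of _ "\<lambda>n. f (X n) (Y n)"]) auto
qed

lemma closure_rational_complex: "closure {z :: complex. Re z \<in> \<rat> \<and> Im z \<in> \<rat>} = UNIV"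
proof -
  have "z \<in> closure {z. Re z \<in> \<rat> \<and> Im z \<in> \<rat>}" for z :: complex
    unfolding closure_approachable
  proof (intro allI impI)
    fix e :: real assume "e > 0"
    have "\<exists>p\<in>\<rat>. \<bar>p - x\<bar> < e / 2" for x :: real
    proof -
      obtain p where "p \<in> \<rat>" "x - e / 2 < p" "p < x + e / 2"
        using Rats_dense_in_real[of "x - e / 2" "x + e / 2"] \<open>e > 0\<close> by auto
      then have "\<bar>p - x\<bar> < e / 2" by linarith
      with \<open>p \<in> \<rat>\<close> show ?thesis ..
    qed
    then obtain p q where "p \<in> \<rat>" "\<bar>p - Re z\<bar> < e / 2" "q \<in> \<rat>" "\<bar>q - Im z\<bar> < e / 2"
      by metis
    then have "cmod (Complex p q - z) < e"
      using cmod_le[of "Complex p q - z"] by simp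
    with \<open>p \<in> \<rat>\<close> \<open>q \<in> \<rat>\<close> show "\<exists>y\<in>{z. Re z \<in> \<rat> \<and> Im z \<in> \<rat>}. dist y z < e"
      by (intro bexI[of _ "Complex p q"]) (auto simp: dist_norm)
  qed
  then show ?thesis by auto
qed

lemma countable_rational_complex: "countable {z :: complex. Re z \<in> \<rat> \<and> Im z \<in> \<rat>}"
proof (rule countable_subset)
  show "{z. Re z \<in> \<rat> \<and> Im z \<in> \<rat>} \<subseteq> (\<lambda>(p, q). Complex p q) ` (\<rat> \<times> \<rat>)"
    by (auto simp: image_iff) (metis complex.collapse)
  show "countable ((\<lambda>(p, q). Complex p q) ` (\<rat> \<times> \<rat>))"
    by (intro countable_image countable_SIGMA countable_rat)
qed

text \<open>The chord is at most the arc. This turns bounds on the cocycle into bounds on the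
  defect.\<close>

lemma cmod_cis_diff_1_le: "cmod (cis t - 1) \<le> \<bar>t\<bar>"
  using dist_exp_i_1[of t] abs_sin_x_le_abs_x[of "t / 2"] by (simp add: cis_conv_exp)

text \<open>Infinitely many copies of the regular representation are used: the index set
  \<open>\<Gamma> \<times> nat\<close> can then be replaced by the type \<open>nat\<close>, although \<open>\<Gamma>\<close> is only a carrier set and
  possibly finite, and the unit of the algebra is the identity operator.\<close>

locale twisted_action = group \<Gamma> for \<Gamma> (structure) +
  fixes \<theta> :: "'g \<Rightarrow> 'g \<Rightarrow> real" and pos :: "'i \<Rightarrow> 'g" and act :: "'g \<Rightarrow> 'i \<Rightarrow> 'i" and base :: 'i
  assumes cocycle: "\<And>a b c. a \<in> carrier \<Gamma> \<Longrightarrow> b \<in> carrier \<Gamma> \<Longrightarrow> c \<in> carrier \<Gamma> \<Longrightarrow>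
      \<theta> b c - \<theta> (a \<otimes> b) c + \<theta> a (b \<otimes> c) - \<theta> a b = 0"
    and normalized: "\<theta> \<one> \<one> = 0"
    and countable_group: "countable (carrier \<Gamma>)"
    and pos_closed: "pos i \<in> carrier \<Gamma>"
    and pos_act: "s \<in> carrier \<Gamma> \<Longrightarrow> pos (act s i) = s \<otimes> pos i"
    and act_act: "s \<in> carrier \<Gamma> \<Longrightarrow> t \<in> carrier \<Gamma> \<Longrightarrow> act s (act t i) = act (s \<otimes> t) i"
    and act_one: "act \<one> i = i"
    and pos_base: "pos base = \<one>"
begin

abbreviation "G \<equiv> carrier \<Gamma>"

section \<open>Twisted translations\<close>

lemma theta_one_left: "a \<in> G \<Longrightarrow> \<theta> \<one> a = 0"
  using cocycle[of \<one> \<one> a] normalized by simp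

lemma theta_one_right: "a \<in> G \<Longrightarrow> \<theta> a \<one> = 0"
  using cocycle[of a \<one> \<one>] normalized by simp

lemma theta_inv: "a \<in> G \<Longrightarrow> \<theta> a (inv a) = \<theta> (inv a) a"
  using cocycle[of a "inv a" a] by (simp add: theta_one_left theta_one_right)

text \<open>On the basis it sends \<open>ket j\<close> to \<open>ket (act s j)\<close> with phase
  \<open>cis (\<theta> s (pos j))\<close>: the twisted left regular representation, in the
  coordinates of the target point.\<close>

definition U :: "'g \<Rightarrow> 'i operator" where
  "U s = (SOME T. (\<forall>f i. coord (app T f) i =
      cis (\<theta> s (inv s \<otimes> pos i)) * coord f (act (inv s) i)) \<and> star T * T = 1)"

lemma U:
  assumes "s \<in> G"
  shows "coord (app (U s) f) i = cis (\<theta> s (inv s \<otimes> pos i)) * coord f (act (inv s) i)"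
    and "star (U s) * U s = 1"
proof -
  have "bij (act (inv s))"
    by (rule o_bij[of "act s"]) (use assms in \<open>auto simp: fun_eq_iff act_act act_one\<close>)
  then have "\<exists>T :: 'i operator. (\<forall>f i. coord (app T f) i =
      cis (\<theta> s (inv s \<otimes> pos i)) * coord f (act (inv s) i)) \<and> star T * T = 1"
    using weighted_composition_operator[of "\<lambda>i. cis (\<theta> s (inv s \<otimes> pos i))" "act (inv s)"]
    by (metis norm_cis)
  then have "(\<forall>f i. coord (app (U s) f) i =
      cis (\<theta> s (inv s \<otimes> pos i)) * coord f (act (inv s) i)) \<and> star (U s) * U s = 1"
    unfolding U_def by (rule someI_ex)
  then show "coord (app (U s) f) i = cis (\<theta> s (inv s \<otimes> pos i)) * coord f (act (inv s) i)"
    and "star (U s) * U s = 1" by blast+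
qed

text \<open>The phases collected at \<open>i\<close> are those of \<theta> s (t c) and \<theta> t c,
  where c is the group element above \<open>i\<close> moved back by s t. The cocycle identity at (s,
  t, c) splits off \<theta> s t.\<close>

lemma U_mult:
  assumes "s \<in> G" "t \<in> G"
  shows "U s * U t = cscale (cis (\<theta> s t)) (U (s \<otimes> t))"
proof (intro operator_eqI ell2_eqI)
  fix f i
  define c where "c = inv t \<otimes> (inv s \<otimes> pos i)"
  have c: "c \<in> G" "t \<otimes> c = inv s \<otimes> pos i" "inv (s \<otimes> t) \<otimes> pos i = c"
    using assms pos_closed[of i] by (simp_all add: c_def inv_mult_group m_assoc inv_solve_left flip: m_assoc[of t])
  have "\<theta> s (t \<otimes> c) + \<theta> t c = \<theta> s t + \<theta> (s \<otimes> t) c"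
    using cocycle[OF assms c(1)] by simp
  then have "cis (\<theta> s (t \<otimes> c)) * cis (\<theta> t c) = cis (\<theta> s t) * cis (\<theta> (s \<otimes> t) c)"
    by (simp add: cis_mult)
  then show "coord (app (U s * U t) f) i = coord (app (cscale (cis (\<theta> s t)) (U (s \<otimes> t))) f) i"
    using assms c pos_closed[of i]
    by (simp add: U(1) pos_act act_act inv_mult_group m_closed flip: c_def)
qed

lemma U_one: "U \<one> = 1"
  by (intro operator_eqI ell2_eqI) (simp add: U(1) theta_one_left pos_closed act_one)

text \<open>\<open>star (U s)\<close> is a left inverse of \<open>U s\<close>, and the rescaled
  \<open>U (inv s)\<close> is a right inverse, so they coincide.\<close>

lemma star_U:
  assumes "s \<in> G"
  shows "star (U s) = cscale (cis (- \<theta> s (inv s))) (U (inv s))"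
proof -
  have "U s * cscale (cis (- \<theta> s (inv s))) (U (inv s)) = 1"
    using assms by (simp add: cscale_simps U_mult U_one cis_mult)
  then have "star (U s) = star (U s) * (U s * cscale (cis (- \<theta> s (inv s))) (U (inv s)))" by simp
  also have "\<dots> = cscale (cis (- \<theta> s (inv s))) (U (inv s))"
    using U(2)[OF assms] by (simp flip: mult.assoc)
  finally show ?thesis .
qed

lemma U_mult_star: "s \<in> G \<Longrightarrow> U s * star (U s) = 1"
  by (simp add: star_U cscale_simps U_mult U_one cis_mult)

lemma norm_U: "s \<in> G \<Longrightarrow> norm (U s) = 1"
  using norm_star_mult_self[of "U s"] U(2)[of s] by (simp add: power2_eq_1_iff) (smt (verit) norm_ge_zero)

text \<open>The vector state at a point above the unit; on the twisted group algebra it is the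
  canonical trace.\<close>

definition \<tau> :: "'i operator \<Rightarrow> complex" where
  "\<tau> T = coord (app T (ket base)) base"

lemma trace_add: "\<tau> (x + y) = \<tau> x + \<tau> y"
  and trace_cscale: "\<tau> (cscale c x) = c * \<tau> x"
  and trace_one: "\<tau> 1 = 1"
  and trace_zero: "\<tau> 0 = 0"
  and trace_star_mult_self: "\<tau> (star x * x) \<in> \<real>\<^sub>\<ge>\<^sub>0"
  unfolding \<tau>_def coord_star_mult_self by simp_all

lemma bounded_linear_trace: "bounded_linear \<tau>"
  unfolding \<tau>_def by (rule bounded_linear_coord_app)

text \<open>An element other than the unit moves \<open>base\<close>, because it moves its position
  in the group; its diagonal entry there is 0.\<close>

lemma trace_U:
  assumes "s \<in> G"
  shows "\<tau> (U s) = (if s = \<one> then 1 else 0)"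
proof (cases "s = \<one>")
  case False
  then have "act (inv s) base \<noteq> base"
    using assms pos_act[of "inv s" base] pos_base by (metis inv_closed inv_equality inv_inv l_inv r_one)
  then show ?thesis using assms False by (simp add: \<tau>_def U(1))
qed (simp add: U_one trace_one)

text \<open>Both traces vanish unless t is the inverse of s, and then \<open>theta_inv\<close> gives
  equal phases.\<close>

lemma trace_U_commute:
  assumes "s \<in> G" "t \<in> G"
  shows "\<tau> (U s * U t) = \<tau> (U t * U s)"
proof (cases "t = inv s")
  case True
  then show ?thesis using assms by (simp add: U_mult trace_cscale theta_inv)
next
  case False
  then have "s \<otimes> t \<noteq> \<one>" "t \<otimes> s \<noteq> \<one>"
    using assms by (metis inv_equality inv_comm)+
  then show ?thesis using assms by (simp add: U_mult trace_cscale trace_U)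
qed

section \<open>The dense subalgebra of finite sums and its closure\<close>

fun lc :: "(complex \<times> 'g) list \<Rightarrow> 'i operator" where
  "lc [] = 0"
| "lc ((c, s) # xs) = cscale c (U s) + lc xs"

definition M :: "'i operator set" where "M = lc ` lists (UNIV \<times> G)"

text \<open>Finite sums are represented by lists of terms: countability of \<open>D\<close> becomes
  countability of a set of lists, and \<open>M\<close> gets an induction that adds one term at a
  time.\<close>

definition D :: "'i operator set" where
  "D = lc ` lists ({z. Re z \<in> \<rat> \<and> Im z \<in> \<rat>} \<times> G)"

definition S :: "'i operator set" where "S = closure D"

lemma zero_M: "0 \<in> M"
  unfolding M_def by (rule image_eqI[of _ _ "[]"]) auto

lemma U_M: "s \<in> G \<Longrightarrow> U s \<in> M"
  unfolding M_def by (rule image_eqI[of _ _ "[(1, s)]"]) (auto simp: cscale_simps)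

lemma M_induct [consumes 1, case_names zero step]:
  assumes "x \<in> M" "P 0" "\<And>c s x. s \<in> G \<Longrightarrow> x \<in> M \<Longrightarrow> P x \<Longrightarrow> P (cscale c (U s) + x)"
  shows "P x"
proof -
  have "P (lc xs)" if "xs \<in> lists (UNIV \<times> G)" for xs
    using that
  proof (induction xs)
    case (Cons a xs)
    then show ?case using assms(3)[of "snd a" "lc xs" "fst a"] by (cases a) (auto simp: M_def)
  qed (simp add: assms(2))
  then show ?thesis using assms(1) by (auto simp: M_def)
qed

lemma step_M: "s \<in> G \<Longrightarrow> x \<in> M \<Longrightarrow> cscale c (U s) + x \<in> M"
  unfolding M_def by (auto intro!: image_eqI[of _ _ "(c, s) # _"])

lemma add_M: "x \<in> M \<Longrightarrow> y \<in> M \<Longrightarrow> x + y \<in> M"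
  by (induction x rule: M_induct) (auto simp: add.assoc intro: step_M)

lemma cscale_M: "x \<in> M \<Longrightarrow> cscale c x \<in> M"
  by (induction x rule: M_induct) (auto simp: cscale_simps zero_M intro: step_M)

lemma mult_M:
  assumes "x \<in> M" "y \<in> M"
  shows "x * y \<in> M"
proof -
  have *: "U s * y \<in> M" if "s \<in> G" for s
    using assms(2)
    by (induction y rule: M_induct)
      (use that in \<open>auto simp: zero_M distrib_left cscale_simps U_mult intro!: step_M\<close>)
  show ?thesis
    using assms(1)
    by (induction x rule: M_induct)
      (auto simp: zero_M distrib_right cscale_simps intro!: add_M cscale_M *)
qed

lemma star_zero: "star (0 :: 'i operator) = 0"
  using star_add[of "0 :: 'i operator" 0] by simp

lemma star_M: "x \<in> M \<Longrightarrow> star x \<in> M"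
  by (induction x rule: M_induct)
    (auto simp: zero_M star_zero star_add star_cscale star_U cscale_simps intro: step_M)

lemma trace_commute_M:
  assumes "x \<in> M" "y \<in> M"
  shows "\<tau> (x * y) = \<tau> (y * x)"
proof -
  have *: "\<tau> (U s * y) = \<tau> (y * U s)" if "s \<in> G" for s
    using assms(2)
    by (induction y rule: M_induct)
      (use that in \<open>auto simp: trace_zero algebra_simps cscale_simps trace_add trace_cscale intro: trace_U_commute\<close>)
  show ?thesis
    using assms(1)
    by (induction x rule: M_induct)
      (auto simp: trace_zero algebra_simps cscale_simps trace_add trace_cscale *)
qed

text \<open>The phases in \<open>U_mult\<close> need not be Gaussian rational, so the algebraic
  operations are handled on \<open>M\<close>, while \<open>D\<close> supplies countability.
  Approximating one coefficient at a time shows that sums with complex coefficients are limits of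
  members of \<open>D\<close>.\<close>

lemma closure_M: "S = closure M"
proof (rule antisym)
  show "S \<subseteq> closure M"
    unfolding S_def D_def M_def by (intro closure_mono image_mono lists_mono) auto
  have zero: "0 \<in> D"
    unfolding D_def by (rule image_eqI[of _ _ "[]"]) auto
  have step: "cscale c (U s) + x \<in> S" if "s \<in> G" "x \<in> S" for c s x
  proof -
    obtain C where C: "\<And>n. C n \<in> {z. Re z \<in> \<rat> \<and> Im z \<in> \<rat>}" "C \<longlonglongrightarrow> c"
      using closure_rational_complex closure_sequential[of c "{z. Re z \<in> \<rat> \<and> Im z \<in> \<rat>}"] by auto
    obtain X where X: "\<And>n. X n \<in> D" "X \<longlonglongrightarrow> x"
      using \<open>x \<in> S\<close> unfolding S_def closure_sequential by blast
    have "(\<lambda>n. cscale (C n) (U s)) \<longlonglongrightarrow> cscale c (U s)"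
    proof -
      have "cscale (C n) (U s) - cscale c (U s) = cscale (C n - c) (U s)" for n
        by (rule operator_eqI) (simp add: cmul_add_left[of "C n - c" c, simplified])
      then have "dist (cscale (C n) (U s)) (cscale c (U s)) = dist (C n) c" for n
        by (simp add: dist_norm norm_cscale norm_U \<open>s \<in> G\<close>)
      then show ?thesis using C(2) by (simp add: tendsto_dist_iff[of _ "cscale c (U s)"] tendsto_dist_iff[of _ c])
    qed
    then have "(\<lambda>n. cscale (C n) (U s) + X n) \<longlonglongrightarrow> cscale c (U s) + x"
      using X(2) by (rule tendsto_add)
    moreover have "cscale (C n) (U s) + X n \<in> D" for n
    proof -
      obtain xs where "xs \<in> lists ({z. Re z \<in> \<rat> \<and> Im z \<in> \<rat>} \<times> G)" "X n = lc xs"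
        using X(1)[of n] by (auto simp: D_def)
      then show ?thesis
        unfolding D_def using C(1)[of n] \<open>s \<in> G\<close> by (intro image_eqI[of _ _ "(C n, s) # xs"]) auto
    qed
    ultimately show ?thesis
      unfolding S_def closure_sequential by (intro exI[of _ "\<lambda>n. cscale (C n) (U s) + X n"]) simp
  qed
  have "x \<in> S" if "x \<in> M" for x
    using that by (induction x rule: M_induct) (use zero closure_subset step in \<open>auto simp: S_def\<close>)
  then show "closure M \<subseteq> S"
    by (intro closure_minimal) (auto simp: S_def)
qed

sublocale separable_operator_algebra D S
proof
  show "countable D"
    unfolding D_def
    by (intro countable_image countable_lists countable_SIGMA countable_rational_complex countable_group)
  show "S = closure D" by (rule S_def)
  show "1 \<in> S"
    using U_M[OF one_closed] closure_subset unfolding closure_M U_one by blast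
  show "x + y \<in> S" if "x \<in> S" "y \<in> S" for x y
    using that unfolding closure_M
    by (rule closure_binary_image[rotated 2]) (auto intro: add_M tendsto_add)
  show "x * y \<in> S" if "x \<in> S" "y \<in> S" for x y
    using that unfolding closure_M
    by (rule closure_binary_image[rotated 2]) (auto intro: mult_M tendsto_mult)
  show "cscale c x \<in> S" if "x \<in> S" for c x
    using that that unfolding closure_M
    by (rule closure_binary_image[where f = "\<lambda>x _. cscale c x", rotated 2])
      (auto intro: cscale_M bounded_linear.tendsto[OF bounded_linear_cscale])
  show "star x \<in> S" if "x \<in> S" for x
    using that that unfolding closure_M
    by (rule closure_binary_image[where f = "\<lambda>x _. star x", rotated 2])
      (auto intro: star_M bounded_linear.tendsto[OF bounded_linear_star])
qed

lemma U_mem: "s \<in> G \<Longrightarrow> U s \<in> S"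
  using U_M closure_subset unfolding closure_M by blast

lemma trace_commute:
  assumes "x \<in> S" "y \<in> S"
  shows "\<tau> (x * y) = \<tau> (y * x)"
proof -
  \<comment> \<open>The commutator expression is continuous and vanishes on \<open>M\<close>, so its
    values on the closure lie in the closure of {0}.\<close>
  have "\<tau> (x * y) - \<tau> (y * x) \<in> closure {0}"
    using assms unfolding closure_M
    by (rule closure_binary_image[rotated 2])
      (auto simp: trace_commute_M
        intro!: tendsto_diff bounded_linear.tendsto[OF bounded_linear_trace] tendsto_mult)
  then show ?thesis by simp
qed

text \<open>The scalar \<open>cis r\<close> has logarithm \<i> r for small r, so it is the imaginary
  part of the trace that reads off the angle.\<close>

sublocale trace: tracial_subalgebra S "\<lambda>x. Im (\<tau> x)"
proof (rule tracial_subalgebra.intro)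
  show "subspace S" by (simp add: subspace_def mem scaleR_mem)
  show "closed S" by (simp add: S_def)
  show "bounded_linear (\<lambda>x. Im (\<tau> x))"
    by (rule bounded_linear_compose[OF bounded_linear_Im bounded_linear_trace])
  show "Im (\<tau> (x * y)) = Im (\<tau> (y * x))" if "x \<in> S" "y \<in> S" for x y
    by (simp only: trace_commute[OF that])
qed (simp_all add: mem)

section \<open>The representation in the coded algebra and its defect\<close>

lemma B_mem: "B \<in> separable_tracial_algebras"
  by (rule coded_in_separable_tracial_algebras[of \<tau>])
    (simp_all only: trace_add trace_cscale trace_star_mult_self trace_one, rule trace_commute)

lemma unital_unitary_map_U: "unital_unitary_map \<Gamma> B (\<lambda>s. code (U s))"
  by (auto simp: unital_unitary_map_def carrier_unitary_group_coded U_one U_mem U(2) U_mult_star)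

lemma defect_U:
  assumes "s \<in> G" "t \<in> G"
  shows "defect \<Gamma> B (\<lambda>s. code (U s)) s t = cmod (1 - cis (\<theta> s t))"
proof -
  have "U (s \<otimes> t) - U s * U t = cscale (1 - cis (\<theta> s t)) (U (s \<otimes> t))"
    using assms cscale_simps(2)[of "1 - cis (\<theta> s t)" "cis (\<theta> s t)" "U (s \<otimes> t)"]
    by (simp add: U_mult cscale_simps algebra_simps)
  then show ?thesis
    using assms by (simp add: defect_def U_mem mem minus_coded norm_cscale norm_U)
qed

text \<open>The lift from the circle to the reals. The bound 1 puts \<open>cis r - 1\<close> into
  the disc of convergence, by the chord estimate, and keeps r between -\<pi> and \<pi>, where the
  principal logarithm of \<open>cis r\<close> is \<i> r.\<close>

lemma trace_log_scalar:
  assumes "\<bar>r\<bar> < 1"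
  shows "trace.trace_log (cscale (cis r - 1) 1) = r"
proof -
  define z where "z = cis r - 1"
  have "cmod z \<le> \<bar>r\<bar>"
    unfolding z_def by (rule cmod_cis_diff_1_le)
  have pow: "(cscale z 1 :: 'i operator) ^ k = cscale (z ^ k) 1" for k
    by (induction k) (simp_all add: cscale_simps mult.commute)
  have "(\<lambda>n. (-1) ^ Suc n / of_nat n * z ^ n) sums ln (1 + z)"
    using \<open>cmod z \<le> \<bar>r\<bar>\<close> assms by (intro Ln_series) simp
  \<comment> \<open>The series of the logarithm is indexed from n = 0, where its term is 0 since
    division by 0 yields 0; dropping it aligns the indices with \<open>trace_log\<close>.\<close>
  then have "(\<lambda>n. (-1) ^ Suc (Suc n) / of_nat (Suc n) * z ^ Suc n) sums ln (1 + z)"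
    by (subst sums_Suc_iff) simp
  then have "(\<lambda>n. Im ((-1) ^ Suc (Suc n) / of_nat (Suc n) * z ^ Suc n)) sums Im (ln (1 + z))"
    by (rule sums_Im)
  moreover have "Im ((-1) ^ Suc (Suc n) / of_nat (Suc n) * z ^ Suc n)
      = (-1) ^ n / (real n + 1) * Im (\<tau> (cscale z 1 ^ Suc n))" for n
  proof -
    have "((-1) ^ Suc (Suc n) / of_nat (Suc n) :: complex) = complex_of_real ((-1) ^ n / (real n + 1))"
      by (simp add: add.commute)
    then show ?thesis
      unfolding pow trace_cscale trace_one by (simp del: of_real_divide of_real_power of_real_mult power_Suc)
  qed
  moreover have "Im (ln (1 + z)) = r"
  proof -
    have "ln (cis r) = \<i> * complex_of_real r"
      unfolding cis_conv_exp using assms pi_gt3 by (intro Ln_exp) auto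
    then show ?thesis by (simp add: z_def)
  qed
  ultimately show ?thesis
    unfolding trace.trace_log_def z_def[symmetric] by (simp add: sums_iff)
qed

text \<open>Conjugation by \<open>v\<close> passes through powers, and cyclicity removes it under
  the trace. This disposes of the conjugation by the homomorphism in the comparison below.\<close>

lemma trace_log_conj:
  assumes "v \<in> S" "star v * v = 1" "a \<in> S"
  shows "trace.trace_log (v * a * star v) = trace.trace_log a"
proof -
  have "(v * a * star v) ^ Suc k = v * a ^ Suc k * star v" for k
  proof (induction k)
    case (Suc k)
    have "(v * a * star v) ^ Suc (Suc k) = v * a * (star v * v) * a ^ Suc k * star v"
      using Suc.IH by (simp add: mult.assoc)
    then show ?case using assms(2) by (simp add: mult.assoc)
  qed simp
  moreover have "\<tau> (v * a ^ Suc k * star v) = \<tau> (a ^ Suc k)" for k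
  proof -
    have "\<tau> (v * (a ^ Suc k * star v)) = \<tau> (a ^ Suc k * star v * v)"
      using assms by (intro trace_commute mem trace.power_mem)
    then show ?thesis using assms(2) by (simp add: mult.assoc)
  qed
  ultimately show ?thesis unfolding trace.trace_log_def by simp
qed

lemma norm_mult_star_unitary:
  assumes "star v * v = 1"
  shows "norm (x * star v) \<le> norm x"
proof -
  have "(norm v)\<^sup>2 = 1" using assms norm_star_mult_self[of v] by simp
  then have "norm (star v) = 1" by (simp add: norm_star power2_eq_1_iff) (smt (verit) norm_ge_zero)
  then show ?thesis using norm_mult_ineq[of x "star v"] by simp
qed

text \<open>If \<open>\<pi>\<close> is a homomorphism, the unitaries \<open>x s = U s (\<pi> s)\<^sup>*\<close> satisfy
  \<open>x s (\<pi> s x t (\<pi> s)\<^sup>*) = exp (i \<theta> s t) x (s t)\<close>; take \<open>Im \<circ> \<tau> \<circ> log\<close> of both sides.\<close>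

lemma cocycle_trivial_near_hom:
  assumes \<pi>: "\<pi> \<in> hom \<Gamma> (unitary_group B)"
  obtains \<gamma> where "\<And>s t. s \<in> G \<Longrightarrow> t \<in> G \<Longrightarrow> \<bar>\<theta> s t\<bar> \<le> 1/4 \<Longrightarrow>
    (\<And>r. r \<in> {s, t, s \<otimes> t} \<Longrightarrow> cnorm B (code (U r) \<ominus>\<^bsub>B\<^esub> \<pi> r) \<le> 1/4) \<Longrightarrow>
    \<theta> s t = \<gamma> s - \<gamma> (s \<otimes> t) + \<gamma> t"
proof
  define P where "P s = decode (\<pi> s)" for s
  have P: "P s \<in> S" "\<pi> s = code (P s)" "star (P s) * P s = 1" "P s * star (P s) = 1" if "s \<in> G" for s
  proof -
    have "\<pi> s \<in> code ` {u \<in> S. star u * u = 1 \<and> u * star u = 1}"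
      using \<pi> that unfolding hom_def carrier_unitary_group_coded by blast
    then show "P s \<in> S" "\<pi> s = code (P s)" "star (P s) * P s = 1" "P s * star (P s) = 1"
      by (auto simp: P_def)
  qed
  have P_mult: "P (s \<otimes> t) = P s * P t" if "s \<in> G" "t \<in> G" for s t
  proof -
    have "code (P (s \<otimes> t)) = code (P s) \<otimes>\<^bsub>B\<^esub> code (P t)"
      using \<pi> that P(2) by (simp add: hom_def unitary_group_def)
    then show ?thesis using that P(1) by (metis coded_simps(4) decode_code m_closed mult_mem)
  qed
  \<comment> \<open>1 + a s is the unitary near 1 attached to s, and the cochain will be
    \<open>trace_log\<close> of \<open>a\<close>. It depends on the homomorphism alone and so is the
    same for all pairs. The bounds 1/4 are those of \<open>trace_log_mult\<close>, applied to both
    sides of the product identity.\<close>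
  define a where "a s = U s * star (P s) - 1" for s
  fix s t
  assume s: "s \<in> G" and t: "t \<in> G" and \<theta>: "\<bar>\<theta> s t\<bar> \<le> 1/4"
    and near: "\<And>r. r \<in> {s, t, s \<otimes> t} \<Longrightarrow> cnorm B (code (U r) \<ominus>\<^bsub>B\<^esub> \<pi> r) \<le> 1/4"
  have st: "s \<otimes> t \<in> G" using s t by simp
  have a: "a r \<in> S" "norm (a r) \<le> 1/4" if "r \<in> {s, t, s \<otimes> t}" for r
  proof -
    have r: "r \<in> G" using that s t by auto
    show "a r \<in> S" unfolding a_def using r P by (intro mem U_mem)
    have "a r = (U r - P r) * star (P r)" using P(4)[OF r] by (simp add: a_def algebra_simps)
    then have "norm (a r) \<le> norm (U r - P r)"
      using norm_mult_star_unitary P(3)[OF r] by simp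
    also have "\<dots> \<le> 1/4" using near[OF that] r P by (simp add: minus_coded U_mem mem)
    finally show "norm (a r) \<le> 1/4" .
  qed
  let ?a' = "P s * a t * star (P s)" and ?z = "cscale (cis (\<theta> s t) - 1) 1 :: 'i operator"
  have a': "?a' \<in> S" "norm ?a' \<le> 1/4"
  proof -
    show "?a' \<in> S" using a P s by (intro mem) auto
    have "norm (P s) = 1" using norm_star_mult_self[of "P s"] P(3)[OF s]
      by (simp add: power2_eq_1_iff) (smt (verit) norm_ge_zero)
    then show "norm ?a' \<le> 1/4"
      using norm_mult_star_unitary[OF P(3)[OF s], of "P s * a t"] norm_mult_ineq[of "P s" "a t"] a(2)[of t]
      by simp
  qed
  have z: "?z \<in> S" "norm ?z \<le> 1/4"
  proof -
    show "?z \<in> S" by (intro mem)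
    have "cmod (cis (\<theta> s t) - 1) \<le> \<bar>\<theta> s t\<bar>" by (rule cmod_cis_diff_1_le)
    then show "norm ?z \<le> 1/4" using \<theta> by (simp add: norm_cscale)
  qed
  \<comment> \<open>On the left \<open>star (P s) * P s\<close> cancels between \<open>U s\<close>
    and \<open>U t\<close>. The homomorphism property merges the remaining adjoints, and
    \<open>U_mult\<close> contributes the phase.\<close>
  have "(1 + a s) * (1 + ?a') = (1 + ?z) * (1 + a (s \<otimes> t))"
  proof -
    have "1 + ?a' = P s * (U t * star (P t)) * star (P s)"
      using P(4)[OF s] by (simp add: a_def algebra_simps)
    then have "(1 + a s) * (1 + ?a') = U s * (star (P s) * P s) * U t * (star (P t) * star (P s))"
      by (simp add: a_def mult.assoc)
    also have "\<dots> = U s * U t * star (P (s \<otimes> t))"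
      using P(3)[OF s] P_mult[OF s t] by (simp add: star_mult)
    also have "\<dots> = cscale (cis (\<theta> s t)) (1 + a (s \<otimes> t))"
      using s t by (simp add: U_mult a_def cscale_simps)
    also have "\<dots> = (1 + ?z) * (1 + a (s \<otimes> t))"
    proof -
      have "1 + ?z = cscale (cis (\<theta> s t)) 1"
        using cscale_simps(2)[of 1 "cis (\<theta> s t) - 1" "1 :: 'i operator"] by (simp add: cscale_simps(4))
      then show ?thesis by (simp add: cscale_simps)
    qed
    finally show ?thesis .
  qed
  then have "trace.trace_log (a s) + trace.trace_log ?a' = trace.trace_log ?z + trace.trace_log (a (s \<otimes> t))"
    using trace.trace_log_mult[of "a s" ?a'] trace.trace_log_mult[of ?z "a (s \<otimes> t)"] a a' z by simp
  moreover have "trace.trace_log ?z = \<theta> s t"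
    using \<theta> by (intro trace_log_scalar) simp
  moreover have "trace.trace_log ?a' = trace.trace_log (a t)"
    using P[OF s] a by (intro trace_log_conj) auto
  ultimately show "\<theta> s t = trace.trace_log (a s) - trace.trace_log (a (s \<otimes> t)) + trace.trace_log (a t)"
    by simp
qed

end

section \<open>Cohomology\<close>

text \<open>\<open>d\<close> and \<open>e\<close> are mutually inverse bijections between
  \<open>nat\<close> and the infinite set \<Gamma> \<times> nat. The group translates the first
  component, which is also the position, and the second one labels the copy.\<close>

lemma free_action_on_nat:
  assumes "group \<Gamma>" "countable (carrier \<Gamma>)"
  obtains pos :: "nat \<Rightarrow> 'g" and act base where
    "\<And>i. pos i \<in> carrier \<Gamma>"
    "\<And>s i. s \<in> carrier \<Gamma> \<Longrightarrow> pos (act s i) = s \<otimes>\<^bsub>\<Gamma>\<^esub> pos i"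
    "\<And>s t i. s \<in> carrier \<Gamma> \<Longrightarrow> t \<in> carrier \<Gamma> \<Longrightarrow> act s (act t i) = act (s \<otimes>\<^bsub>\<Gamma>\<^esub> t) i"
    "\<And>i. act \<one>\<^bsub>\<Gamma>\<^esub> i = i"
    "pos base = \<one>\<^bsub>\<Gamma>\<^esub>"
proof
  interpret group \<Gamma> by fact
  let ?X = "carrier \<Gamma> \<times> (UNIV :: nat set)"
  have X: "countable ?X" "infinite ?X"
    using assms(2) one_closed by (auto simp: finite_cartesian_product_iff)
  define d e where "d = from_nat_into ?X" and "e = to_nat_on ?X"
  have d: "d i \<in> ?X" and ed: "e (d i) = i" for i
    using X from_nat_into[of ?X i] infinite_imp_nonempty by (auto simp: d_def e_def to_nat_on_from_nat_into_infinite)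
  have de: "d (e x) = x" if "x \<in> ?X" for x
    using X that by (simp add: d_def e_def)
  show pos: "fst (d i) \<in> carrier \<Gamma>" for i
    using d[of i] by auto
  show "fst (d (e (s \<otimes>\<^bsub>\<Gamma>\<^esub> fst (d i), snd (d i)))) = s \<otimes>\<^bsub>\<Gamma>\<^esub> fst (d i)" if "s \<in> carrier \<Gamma>" for s i
    using that pos by (subst de) auto
  show "e (s \<otimes>\<^bsub>\<Gamma>\<^esub> fst (d (e (t \<otimes>\<^bsub>\<Gamma>\<^esub> fst (d i), snd (d i)))), snd (d (e (t \<otimes>\<^bsub>\<Gamma>\<^esub> fst (d i), snd (d i)))))
      = e (s \<otimes>\<^bsub>\<Gamma>\<^esub> t \<otimes>\<^bsub>\<Gamma>\<^esub> fst (d i), snd (d i))" if "s \<in> carrier \<Gamma>" "t \<in> carrier \<Gamma>" for s t i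
    using that pos by (simp add: de m_assoc)
  show "e (\<one>\<^bsub>\<Gamma>\<^esub> \<otimes>\<^bsub>\<Gamma>\<^esub> fst (d i), snd (d i)) = i" for i
    using pos by (simp add: ed)
  show "fst (d (e (\<one>\<^bsub>\<Gamma>\<^esub>, 0))) = \<one>\<^bsub>\<Gamma>\<^esub>"
    by (simp add: de)
qed

text \<open>Linear compactness: the equations prescribe a linear functional on the vectors
  \<open>e a - e (a b) + e b\<close>, and solvability of the finite subsystems says that this is consistent
  with all linear relations between them.\<close>

lemma coboundary_if_finitely:
  fixes \<omega> :: "'g \<Rightarrow> 'g \<Rightarrow> real" and m :: "'g \<Rightarrow> 'g \<Rightarrow> 'g"
  assumes "\<And>F. finite F \<Longrightarrow> F \<subseteq> J \<Longrightarrow> \<exists>\<gamma>. \<forall>(a, b)\<in>F. \<omega> a b = \<gamma> a - \<gamma> (m a b) + \<gamma> b"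
  shows "\<exists>\<gamma>. \<forall>(a, b)\<in>J. \<omega> a b = \<gamma> a - \<gamma> (m a b) + \<gamma> b"
proof -
  \<comment> \<open>The \<open>ell2\<close> space over the group elements serves as a real vector
    space with the independent family \<open>ket\<close>.\<close>
  define v where "v = (\<lambda>(a, b). ket a - ket (m a b) + ket b)"
  obtain W where W: "W \<subseteq> v ` J" "independent W" "v ` J \<subseteq> span W"
    by (rule maximal_independent_subset)
  obtain p where p: "\<And>w. w \<in> W \<Longrightarrow> p w \<in> J \<and> v (p w) = w"
    using W(1) by (metis (no_types, opaque_lifting) image_iff subsetD)
  \<comment> \<open>\<open>L\<close> is prescribed on a basis chosen among the vectors
    \<open>v\<close>; the remaining equations have to follow.\<close>
  obtain L where L: "linear L" "\<And>w. w \<in> W \<Longrightarrow> L w = (case p w of (a, b) \<Rightarrow> \<omega> a b)"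
    using linear_independent_extend[OF W(2), of "\<lambda>w. case p w of (a, b) \<Rightarrow> \<omega> a b"] by auto
  have "\<omega> a b = L (ket a) - L (ket (m a b)) + L (ket b)" if "(a, b) \<in> J" for a b
  proof -
    have "v (a, b) \<in> span W" using W(3) that by auto
    then obtain T r where T: "finite T" "T \<subseteq> W" "v (a, b) = (\<Sum>w\<in>T. r w *\<^sub>R w)"
      unfolding span_explicit by auto
    \<comment> \<open>The finite subsystem to solve: the equation under consideration together with
      those of the basis vectors in its expansion.\<close>
    define F where "F = insert (a, b) (p ` T)"
    have F: "finite F" "F \<subseteq> J" using T p that by (auto simp: F_def)
    obtain \<gamma> where "\<forall>(c, d)\<in>F. \<omega> c d = \<gamma> c - \<gamma> (m c d) + \<gamma> d"
      using assms[OF F] by (rule exE)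
    then have \<gamma>: "\<And>c d. (c, d) \<in> F \<Longrightarrow> \<omega> c d = \<gamma> c - \<gamma> (m c d) + \<gamma> d"
      by blast
    define X where "X = (\<Union>(c, d)\<in>F. {c, m c d, d})"
    have X: "finite X" using F(1) by (auto simp: X_def)
    \<comment> \<open>The functional given by the finite solution: it takes the value
      \<open>\<gamma> x\<close> at \<open>ket x\<close> for x in \<open>X\<close>. It agrees with
      \<open>L\<close> on \<open>T\<close>, hence at \<open>v (a, b)\<close>, where it has the
      prescribed value.\<close>
    define E where "E f = (\<Sum>x\<in>X. \<gamma> x * Re (coord f x))" for f
    have linE: "linear E"
      unfolding E_def
      by (rule linearI) (simp_all add: algebra_simps sum.distrib sum_distrib_left)
    have E_ket: "E (ket x) = \<gamma> x" if "x \<in> X" for x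
    proof -
      have "E (ket x) = (\<Sum>y\<in>X. if y = x then \<gamma> y else 0)"
        unfolding E_def by (rule sum.cong) auto
      then show ?thesis using X that by simp
    qed
    have E_v: "E (v (c, d)) = \<omega> c d" if "(c, d) \<in> F" for c d
    proof -
      have "{c, m c d, d} \<subseteq> X" using that by (auto simp: X_def)
      then show ?thesis
        using \<gamma>[OF that] by (simp add: v_def linear_add[OF linE] linear_diff[OF linE] E_ket)
    qed
    have "E w = L w" if "w \<in> T" for w
    proof -
      obtain c d where cd: "p w = (c, d)" by force
      then have "(c, d) \<in> F" using that by (force simp: F_def)
      then show ?thesis using E_v[of c d] L(2)[of w] p[of w] T(2) that cd by auto
    qed
    then have "E (v (a, b)) = L (v (a, b))"
      unfolding T(3) by (simp add: linear_sum[OF linE] linear_sum[OF L(1)] linear_scale[OF linE] linear_scale[OF L(1)])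
    then have "\<omega> a b = L (v (a, b))" using E_v[of a b] by (simp add: F_def)
    then show ?thesis by (simp add: v_def linear_add[OF L(1)] linear_diff[OF L(1)])
  qed
  then show ?thesis by (intro exI[of _ "\<lambda>x. L (ket x)"]) auto
qed

text \<open>Shared by both halves of the theorem: the defect bound is pointwise in (s, t), so it
  gives local convergence for every cocycle and uniform convergence for a bounded one.\<close>

lemma twisted_representations:
  fixes \<Gamma> :: "('g, 'k) monoid_scheme"
  assumes "group \<Gamma>" "countable (carrier \<Gamma>)" and \<omega>: "\<omega> \<in> cocycles2 \<Gamma>"
  obtains B :: "nat \<Rightarrow> (nat \<Rightarrow> complex) cstar_struct" and \<rho> where
    "\<And>n. B n \<in> separable_tracial_algebras" "\<And>n. unital_unitary_map \<Gamma> (B n) (\<rho> n)"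
    "\<And>n s t. s \<in> carrier \<Gamma> \<Longrightarrow> t \<in> carrier \<Gamma> \<Longrightarrow>
      defect \<Gamma> (B n) (\<rho> n) s t \<le> \<bar>\<omega> (s, t) - \<omega> (\<one>\<^bsub>\<Gamma>\<^esub>, \<one>\<^bsub>\<Gamma>\<^esub>)\<bar> / real (Suc n)"
    "pointwise_near_homs \<Gamma> B \<rho> \<Longrightarrow> \<omega> \<in> coboundaries2 \<Gamma>"
proof -
  interpret group \<Gamma> by fact
  let ?k = "\<omega> (\<one>\<^bsub>\<Gamma>\<^esub>, \<one>\<^bsub>\<Gamma>\<^esub>)"
  \<comment> \<open>The constant cocycle \<open>?k\<close> is the coboundary of the constant
    function \<open>?k\<close>, so subtracting it keeps the class and normalizes at the unit.
    \<open>Suc n\<close> avoids division by 0.\<close>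
  define \<theta> where "\<theta> n s t = (\<omega> (s, t) - ?k) / real (Suc n)" for n s t
  obtain pos :: "nat \<Rightarrow> 'g" and act base where action:
    "\<And>i. pos i \<in> carrier \<Gamma>"
    "\<And>s i. s \<in> carrier \<Gamma> \<Longrightarrow> pos (act s i) = s \<otimes>\<^bsub>\<Gamma>\<^esub> pos i"
    "\<And>s t i. s \<in> carrier \<Gamma> \<Longrightarrow> t \<in> carrier \<Gamma> \<Longrightarrow> act s (act t i) = act (s \<otimes>\<^bsub>\<Gamma>\<^esub> t) i"
    "\<And>i. act \<one>\<^bsub>\<Gamma>\<^esub> i = i"
    "pos base = \<one>\<^bsub>\<Gamma>\<^esub>"
    using free_action_on_nat[OF assms(1,2)] by blast
  have tw: "twisted_action \<Gamma> (\<theta> n) pos act base" for n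
  proof (intro twisted_action.intro twisted_action_axioms.intro assms(1,2) action)
    fix a b c assume "a \<in> carrier \<Gamma>" "b \<in> carrier \<Gamma>" "c \<in> carrier \<Gamma>"
    then have "\<omega> (b, c) - \<omega> (a \<otimes>\<^bsub>\<Gamma>\<^esub> b, c) + \<omega> (a, b \<otimes>\<^bsub>\<Gamma>\<^esub> c) - \<omega> (a, b) = 0"
      using \<omega> by (simp add: cocycles2_def)
    then show "\<theta> n b c - \<theta> n (a \<otimes>\<^bsub>\<Gamma>\<^esub> b) c + \<theta> n a (b \<otimes>\<^bsub>\<Gamma>\<^esub> c) - \<theta> n a b = 0"
      by (simp add: \<theta>_def flip: diff_divide_distrib add_divide_distrib)
  qed (simp_all add: \<theta>_def)
  interpret tw: twisted_action \<Gamma> "\<theta> n" pos act base for n by (rule tw)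
  let ?B = "\<lambda>n. tw.coded_algebra n" and ?\<rho> = "\<lambda>n s. tw.code n (tw.U n s)"
  show thesis
  proof
    show "?B n \<in> separable_tracial_algebras" "unital_unitary_map \<Gamma> (?B n) (?\<rho> n)" for n
      by (rule tw.B_mem tw.unital_unitary_map_U)+
    show "defect \<Gamma> (?B n) (?\<rho> n) s t \<le> \<bar>\<omega> (s, t) - ?k\<bar> / real (Suc n)"
      if "s \<in> carrier \<Gamma>" "t \<in> carrier \<Gamma>" for n s t
      using cmod_cis_diff_1_le[of "\<theta> n s t"] tw.defect_U[OF that]
      by (simp add: \<theta>_def norm_minus_commute abs_divide del: of_nat_Suc)
    assume "pointwise_near_homs \<Gamma> ?B ?\<rho>"
    then obtain \<pi> where hom: "\<And>n. \<pi> n \<in> hom \<Gamma> (unitary_group (?B n))"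
      and near: "\<And>s. s \<in> carrier \<Gamma> \<Longrightarrow> (\<lambda>n. cnorm (?B n) (?\<rho> n s \<ominus>\<^bsub>?B n\<^esub> \<pi> n s)) \<longlonglongrightarrow> 0"
      unfolding pointwise_near_homs_def by blast
    have "\<exists>\<gamma>. \<forall>(s, t)\<in>carrier \<Gamma> \<times> carrier \<Gamma>. \<omega> (s, t) = \<gamma> s - \<gamma> (s \<otimes>\<^bsub>\<Gamma>\<^esub> t) + \<gamma> t"
    proof (rule coboundary_if_finitely[of _ "\<lambda>s t. \<omega> (s, t)"])
      fix F assume F: "finite F" "F \<subseteq> carrier \<Gamma> \<times> carrier \<Gamma>"
      \<comment> \<open>Each condition holds from an index on that depends on the pair; finiteness
        of \<open>F\<close> makes one index serve all of them.\<close>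
      have "\<forall>\<^sub>F n in sequentially. \<forall>(s, t)\<in>F. \<bar>\<theta> n s t\<bar> \<le> 1/4 \<and>
        (\<forall>r\<in>{s, t, s \<otimes>\<^bsub>\<Gamma>\<^esub> t}. cnorm (?B n) (?\<rho> n r \<ominus>\<^bsub>?B n\<^esub> \<pi> n r) \<le> 1/4)"
      proof (rule eventually_ball_finite[OF F(1)], safe)
        fix s t assume st: "(s, t) \<in> F"
        have "(\<lambda>n. \<theta> n s t) \<longlonglongrightarrow> 0"
          unfolding \<theta>_def by (rule LIMSEQ_Suc) (rule lim_const_over_n)
        then have "\<forall>\<^sub>F n in sequentially. \<bar>\<theta> n s t\<bar> < 1/4"
          by (auto dest: order_tendstoD(2)[OF tendsto_rabs, of _ 0 _ "1/4"])
        moreover have "\<forall>\<^sub>F n in sequentially. cnorm (?B n) (?\<rho> n r \<ominus>\<^bsub>?B n\<^esub> \<pi> n r) < 1/4"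
          if "r \<in> {s, t, s \<otimes>\<^bsub>\<Gamma>\<^esub> t}" for r
          using near[of r] that st F(2) by (intro order_tendstoD(2)) auto
        then have "\<forall>\<^sub>F n in sequentially. \<forall>r\<in>{s, t, s \<otimes>\<^bsub>\<Gamma>\<^esub> t}. cnorm (?B n) (?\<rho> n r \<ominus>\<^bsub>?B n\<^esub> \<pi> n r) < 1/4"
          by (intro eventually_ball_finite) auto
        ultimately show "\<forall>\<^sub>F n in sequentially. \<bar>\<theta> n s t\<bar> \<le> 1/4 \<and>
            (\<forall>r\<in>{s, t, s \<otimes>\<^bsub>\<Gamma>\<^esub> t}. cnorm (?B n) (?\<rho> n r \<ominus>\<^bsub>?B n\<^esub> \<pi> n r) \<le> 1/4)"
          by eventually_elim (meson less_imp_le)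
      qed
      then obtain n where n: "\<And>s t. (s, t) \<in> F \<Longrightarrow> \<bar>\<theta> n s t\<bar> \<le> 1/4"
        "\<And>s t r. (s, t) \<in> F \<Longrightarrow> r \<in> {s, t, s \<otimes>\<^bsub>\<Gamma>\<^esub> t} \<Longrightarrow> cnorm (?B n) (?\<rho> n r \<ominus>\<^bsub>?B n\<^esub> \<pi> n r) \<le> 1/4"
        unfolding eventually_sequentially by blast
      obtain \<gamma> where \<gamma>: "\<And>s t. s \<in> carrier \<Gamma> \<Longrightarrow> t \<in> carrier \<Gamma> \<Longrightarrow> \<bar>\<theta> n s t\<bar> \<le> 1/4 \<Longrightarrow>
          (\<And>r. r \<in> {s, t, s \<otimes>\<^bsub>\<Gamma>\<^esub> t} \<Longrightarrow> cnorm (?B n) (?\<rho> n r \<ominus>\<^bsub>?B n\<^esub> \<pi> n r) \<le> 1/4) \<Longrightarrow>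
          \<theta> n s t = \<gamma> s - \<gamma> (s \<otimes>\<^bsub>\<Gamma>\<^esub> t) + \<gamma> t"
        using tw.cocycle_trivial_near_hom[OF hom] by blast
      \<comment> \<open>Scaling and normalization are undone: the added constant contributes k - k +
        k = k.\<close>
      have "\<omega> (s, t) = (real (Suc n) * \<gamma> s + ?k) - (real (Suc n) * \<gamma> (s \<otimes>\<^bsub>\<Gamma>\<^esub> t) + ?k) + (real (Suc n) * \<gamma> t + ?k)"
        if "(s, t) \<in> F" for s t
      proof -
        have eq: "\<theta> n s t = \<gamma> s - \<gamma> (s \<otimes>\<^bsub>\<Gamma>\<^esub> t) + \<gamma> t"
          using that F(2) by (intro \<gamma> n[OF that]) auto
        have "\<omega> (s, t) = real (Suc n) * \<theta> n s t + ?k"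
          by (simp add: \<theta>_def del: of_nat_Suc)
        then show ?thesis unfolding eq by (simp add: algebra_simps del: of_nat_Suc)
      qed
      then show "\<exists>\<gamma>. \<forall>(s, t)\<in>F. \<omega> (s, t) = \<gamma> s - \<gamma> (s \<otimes>\<^bsub>\<Gamma>\<^esub> t) + \<gamma> t"
        by (intro exI[of _ "\<lambda>s. real (Suc n) * \<gamma> s + ?k"]) blast
    qed
    then obtain \<gamma> where \<gamma>: "\<And>s t. s \<in> carrier \<Gamma> \<Longrightarrow> t \<in> carrier \<Gamma> \<Longrightarrow> \<omega> (s, t) = \<gamma> s - \<gamma> (s \<otimes>\<^bsub>\<Gamma>\<^esub> t) + \<gamma> t"
      by blast
    have "\<omega> \<in> extensional (carrier \<Gamma> \<times> carrier \<Gamma>)"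
      using \<omega> by (auto simp: cocycles2_def PiE_def)
    then have "\<omega> = coboundary \<Gamma> (restrict \<gamma> (carrier \<Gamma>))"
      by (intro extensionalityI[of _ "carrier \<Gamma> \<times> carrier \<Gamma>"]) (auto simp: coboundary_def \<gamma>)
    then show "\<omega> \<in> coboundaries2 \<Gamma>"
      by (auto simp: coboundaries2_def real_add_group_def)
  qed
qed

section \<open>Cosets and the comparison map\<close>

lemma coboundaries2_coset:
  assumes "group \<Gamma>" "\<omega> \<in> coboundaries2 \<Gamma>"
  shows "coboundaries2 \<Gamma> #>\<^bsub>cochains2 \<Gamma>\<^esub> \<omega> = coboundaries2 \<Gamma>"
proof -
  interpret group \<Gamma> by fact
  obtain \<gamma> where \<omega>: "\<omega> = coboundary \<Gamma> \<gamma>"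
    using assms(2) by (auto simp: coboundaries2_def)
  have add: "coboundary \<Gamma> \<beta> \<otimes>\<^bsub>cochains2 \<Gamma>\<^esub> \<omega> = coboundary \<Gamma> (\<lambda>a\<in>carrier \<Gamma>. \<beta> a + \<gamma> a)" for \<beta>
    unfolding \<omega> by (rule ext) (auto simp: coboundary_def real_add_group_def)
  have sub: "coboundary \<Gamma> \<beta> = coboundary \<Gamma> (\<lambda>a\<in>carrier \<Gamma>. \<beta> a - \<gamma> a) \<otimes>\<^bsub>cochains2 \<Gamma>\<^esub> \<omega>" for \<beta>
    unfolding add by (rule ext) (auto simp: coboundary_def)
  show ?thesis
  proof (intro subset_antisym subsetI)
    fix x assume "x \<in> coboundaries2 \<Gamma> #>\<^bsub>cochains2 \<Gamma>\<^esub> \<omega>"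
    then obtain \<beta> where "x = coboundary \<Gamma> \<beta> \<otimes>\<^bsub>cochains2 \<Gamma>\<^esub> \<omega>"
      unfolding r_coset_def coboundaries2_def by auto
    then show "x \<in> coboundaries2 \<Gamma>"
      unfolding add coboundaries2_def by (simp add: real_add_group_def)
  next
    fix x assume "x \<in> coboundaries2 \<Gamma>"
    then obtain \<beta> where x: "x = coboundary \<Gamma> \<beta>" by (auto simp: coboundaries2_def)
    have "coboundary \<Gamma> (\<lambda>a\<in>carrier \<Gamma>. \<beta> a - \<gamma> a) \<in> coboundaries2 \<Gamma>"
      unfolding coboundaries2_def by (intro imageI) (simp add: real_add_group_def PiE_def extensional_def)
    then show "x \<in> coboundaries2 \<Gamma> #>\<^bsub>cochains2 \<Gamma>\<^esub> \<omega>"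
      unfolding r_coset_def x by (subst sub) blast
  qed
qed

lemma coboundaries2_subset_cocycles2_trivial:
  assumes "group \<Gamma>" "cocycles2 \<Gamma> \<subseteq> coboundaries2 \<Gamma>"
  shows "carrier (H2 \<Gamma>) = {\<one>\<^bsub>H2 \<Gamma>\<^esub>}"
proof -
  \<comment> \<open>The zero cocycle ensures that the quotient has an element at all, so that it
    equals the singleton and not the empty set.\<close>
  have "(\<lambda>_\<in>carrier \<Gamma> \<times> carrier \<Gamma>. 0) \<in> cocycles2 \<Gamma>"
    using assms(1) by (auto simp: cocycles2_def real_add_group_def group.is_monoid monoid.m_closed)
  then show ?thesis
    using coboundaries2_coset[OF assms(1)] assms(2)
    by (auto simp: H2_def FactGroup_def RCOSETS_def r_coset_def subset_iff)
qed

lemma comparison_map_trivial: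
  assumes "group \<Gamma>" "bounded_cocycles2 \<Gamma> \<subseteq> coboundaries2 \<Gamma>" "X \<in> carrier (H2b \<Gamma>)"
  shows "comparison_map \<Gamma> X = \<one>\<^bsub>H2 \<Gamma>\<^esub>"
proof -
  obtain \<omega> where \<omega>: "\<omega> \<in> bounded_cocycles2 \<Gamma>"
    and X: "X = bounded_coboundaries2 \<Gamma> #>\<^bsub>cochains2 \<Gamma>\<^esub> \<omega>"
    using assms(3) by (auto simp: H2b_def FactGroup_def RCOSETS_def r_coset_def)
  have "X \<subseteq> coboundaries2 \<Gamma> #>\<^bsub>cochains2 \<Gamma>\<^esub> \<omega>"
    unfolding X r_coset_def bounded_coboundaries2_def coboundaries2_def by auto
  then have "X \<subseteq> coboundaries2 \<Gamma>"
    using coboundaries2_coset[OF assms(1)] assms(2) \<omega> by auto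
  \<comment> \<open>For \<open>the_elem\<close> the set of cosets must be exactly a singleton, hence
    the nonemptiness.\<close>
  moreover have "X \<noteq> {}"
    unfolding X r_coset_def bounded_coboundaries2_def
    by (auto intro!: exI[of _ "\<lambda>_\<in>carrier \<Gamma>. 0"] simp: real_add_group_def bounded_iff)
  ultimately have "(\<lambda>\<omega>'. coboundaries2 \<Gamma> #>\<^bsub>cochains2 \<Gamma>\<^esub> \<omega>') ` X = {coboundaries2 \<Gamma>}"
    using coboundaries2_coset[OF assms(1)] by auto
  then show ?thesis
    by (simp add: comparison_map_def H2_def FactGroup_def)
qed

lemma defect_nonneg:
  assumes "group \<Gamma>" "B \<in> separable_tracial_algebras" "unital_unitary_map \<Gamma> B \<rho>"
    and "s \<in> carrier \<Gamma>" "t \<in> carrier \<Gamma>"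
  shows "0 \<le> defect \<Gamma> B \<rho> s t"
proof -
  interpret \<Gamma>: group \<Gamma> by fact
  interpret B: unital_cstar_algebra B
    using assms(2) by (simp add: separable_tracial_algebras_def)
  have "\<rho> r \<in> carrier B" if "r \<in> carrier \<Gamma>" for r
    using assms(3) that by (auto simp: unital_unitary_map_def unitary_group_def)
  then show ?thesis
    unfolding defect_def using assms(4,5) by (intro B.cnorm_nonneg) auto
qed

theorem theorem1p2:
  fixes \<Gamma> :: "('g, 'k) monoid_scheme"
    and \<B> :: "(nat \<Rightarrow> complex) cstar_struct set"
  assumes "group \<Gamma>"
    and "countable (carrier \<Gamma>)"
    and "\<B> = separable_tracial_algebras"
  shows "(carrier (H2 \<Gamma>) \<noteq> {\<one>\<^bsub>H2 \<Gamma>\<^esub>} \<longrightarrow> \<not> local_to_local_stable \<Gamma> \<B>) \<and>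
    ((\<exists>X\<in>carrier (H2b \<Gamma>). comparison_map \<Gamma> X \<noteq> \<one>\<^bsub>H2 \<Gamma>\<^esub>) \<longrightarrow>
       \<not> uniform_to_local_stable \<Gamma> \<B>)"
proof (intro conjI impI notI)
  interpret group \<Gamma> by fact
  assume H2: "carrier (H2 \<Gamma>) \<noteq> {\<one>\<^bsub>H2 \<Gamma>\<^esub>}" and stable: "local_to_local_stable \<Gamma> \<B>"
  \<comment> \<open>Stability is applied to the twisted representations of each cocycle in turn,
    which makes every class trivial.\<close>
  have "\<omega> \<in> coboundaries2 \<Gamma>" if \<omega>: "\<omega> \<in> cocycles2 \<Gamma>" for \<omega>
  proof (rule twisted_representations[OF assms(1,2) \<omega>])
    fix B :: "nat \<Rightarrow> (nat \<Rightarrow> complex) cstar_struct" and \<rho>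
    assume B: "\<And>n. B n \<in> separable_tracial_algebras" "\<And>n. unital_unitary_map \<Gamma> (B n) (\<rho> n)"
      and defect: "\<And>n s t. s \<in> carrier \<Gamma> \<Longrightarrow> t \<in> carrier \<Gamma> \<Longrightarrow>
        defect \<Gamma> (B n) (\<rho> n) s t \<le> \<bar>\<omega> (s, t) - \<omega> (\<one>\<^bsub>\<Gamma>\<^esub>, \<one>\<^bsub>\<Gamma>\<^esub>)\<bar> / real (Suc n)"
      and trivial: "pointwise_near_homs \<Gamma> B \<rho> \<Longrightarrow> \<omega> \<in> coboundaries2 \<Gamma>"
    have "(\<lambda>n. defect \<Gamma> (B n) (\<rho> n) s t) \<longlonglongrightarrow> 0" if "s \<in> carrier \<Gamma>" "t \<in> carrier \<Gamma>" for s t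
    proof (rule tendsto_sandwich[OF _ _ tendsto_const])
      show "(\<lambda>n. \<bar>\<omega> (s, t) - \<omega> (\<one>\<^bsub>\<Gamma>\<^esub>, \<one>\<^bsub>\<Gamma>\<^esub>)\<bar> / real (Suc n)) \<longlonglongrightarrow> 0"
        by (rule LIMSEQ_Suc) (rule lim_const_over_n)
    qed (use defect_nonneg[OF assms(1) B] defect that in auto)
    then show ?thesis
      using stable B assms(3) unfolding local_to_local_stable_def by (intro trivial) blast
  qed
  with H2 show False
    using coboundaries2_subset_cocycles2_trivial[OF assms(1)] by blast
next
  interpret group \<Gamma> by fact
  assume H2b: "\<exists>X\<in>carrier (H2b \<Gamma>). comparison_map \<Gamma> X \<noteq> \<one>\<^bsub>H2 \<Gamma>\<^esub>"
    and stable: "uniform_to_local_stable \<Gamma> \<B>"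
  have "\<omega> \<in> coboundaries2 \<Gamma>" if "\<omega> \<in> bounded_cocycles2 \<Gamma>" for \<omega>
  proof -
    have \<omega>: "\<omega> \<in> cocycles2 \<Gamma>" and "bounded (\<omega> ` (carrier \<Gamma> \<times> carrier \<Gamma>))"
      using that by (auto simp: bounded_cocycles2_def)
    then obtain K where K: "\<And>s t. s \<in> carrier \<Gamma> \<Longrightarrow> t \<in> carrier \<Gamma> \<Longrightarrow> \<bar>\<omega> (s, t)\<bar> \<le> K"
      unfolding bounded_iff by auto
    show ?thesis
    proof (rule twisted_representations[OF assms(1,2) \<omega>])
      fix B :: "nat \<Rightarrow> (nat \<Rightarrow> complex) cstar_struct" and \<rho>
      assume B: "\<And>n. B n \<in> separable_tracial_algebras" "\<And>n. unital_unitary_map \<Gamma> (B n) (\<rho> n)"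
        and defect: "\<And>n s t. s \<in> carrier \<Gamma> \<Longrightarrow> t \<in> carrier \<Gamma> \<Longrightarrow>
          defect \<Gamma> (B n) (\<rho> n) s t \<le> \<bar>\<omega> (s, t) - \<omega> (\<one>\<^bsub>\<Gamma>\<^esub>, \<one>\<^bsub>\<Gamma>\<^esub>)\<bar> / real (Suc n)"
        and trivial: "pointwise_near_homs \<Gamma> B \<rho> \<Longrightarrow> \<omega> \<in> coboundaries2 \<Gamma>"
      have le: "defect \<Gamma> (B n) (\<rho> n) s t \<le> 2 * K / real (Suc n)"
        if "s \<in> carrier \<Gamma>" "t \<in> carrier \<Gamma>" for n s t
      proof -
        \<comment> \<open>One \<open>K\<close> bounds the cocycle, the other the value at the unit
          subtracted by the normalization.\<close>
        have "\<bar>\<omega> (s, t) - \<omega> (\<one>\<^bsub>\<Gamma>\<^esub>, \<one>\<^bsub>\<Gamma>\<^esub>)\<bar> \<le> 2 * K"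
          using K[OF that] K[of "\<one>\<^bsub>\<Gamma>\<^esub>" "\<one>\<^bsub>\<Gamma>\<^esub>"] by auto
        then show ?thesis
          by (intro order_trans[OF defect[OF that]] divide_right_mono) auto
      qed
      let ?sup = "\<lambda>n. SUP (s, t)\<in>carrier \<Gamma> \<times> carrier \<Gamma>. defect \<Gamma> (B n) (\<rho> n) s t"
      have "?sup \<longlonglongrightarrow> 0"
      proof (rule tendsto_sandwich[OF _ _ tendsto_const])
        show "(\<lambda>n. 2 * K / real (Suc n)) \<longlonglongrightarrow> 0"
          by (rule LIMSEQ_Suc) (rule lim_const_over_n)
        \<comment> \<open>The unit makes the index set nonempty, as a supremum bounded from above
          requires.\<close>
        have "?sup n \<le> 2 * K / real (Suc n)" for n
          using one_closed le by (intro cSUP_least) auto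
        then show "\<forall>\<^sub>F n in sequentially. ?sup n \<le> 2 * K / real (Suc n)" by simp
        \<comment> \<open>A supremum of reals dominates its members only if the family is bounded
          above, so \<open>le\<close> enters here as well; the pair of units is the member compared
          with 0.\<close>
        have "0 \<le> ?sup n" for n
        proof (rule cSUP_upper2)
          show "bdd_above ((\<lambda>(s, t). defect \<Gamma> (B n) (\<rho> n) s t) ` (carrier \<Gamma> \<times> carrier \<Gamma>))"
            using le by (intro bdd_aboveI[of _ "2 * K / real (Suc n)"]) auto
          show "(\<one>\<^bsub>\<Gamma>\<^esub>, \<one>\<^bsub>\<Gamma>\<^esub>) \<in> carrier \<Gamma> \<times> carrier \<Gamma>" by simp
          show "0 \<le> (case (\<one>\<^bsub>\<Gamma>\<^esub>, \<one>\<^bsub>\<Gamma>\<^esub>) of (s, t) \<Rightarrow> defect \<Gamma> (B n) (\<rho> n) s t)"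
            using defect_nonneg[OF assms(1) B] by simp
        qed
        then show "\<forall>\<^sub>F n in sequentially. 0 \<le> ?sup n" by simp
      qed
      then show ?thesis
        using stable B assms(3) unfolding uniform_to_local_stable_def by (intro trivial) blast
    qed
  qed
  then show False
    using comparison_map_trivial[OF assms(1)] H2b by blast
qed

end
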